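(* In the stochastic opinion dynamics described below, almost surely the vector $\beta(t)$ converges as $t\to\infty$ to a point $\beta^*\in[0,1]^n$ with $F(\beta^* )=\beta^*$.
   Context: Let $A=(a_{i,j})$ be a symmetric $n\times n$ matrix with nonnegative entries, the weighted adjacency matrix of an undirected graph $G$ on $\{1,\dots,n\}$ (self-loops allowed) that is connected and not bipartite; let $\deg(i)=\sum_j a_{i,j}$. Each agent $i$ has a bias parameter $\gamma_i>0$, and $\mathrm{diag}(\gamma_1,\dots,\gamma_n)\neq I$. Define $f(\mu,\gamma)=\frac{\gamma\mu}{1+(\gamma-1)\mu}$ for $\mu\in[0,1]$, and for $\beta\in[0,1]^n$ let $\mu_i(\beta)=\frac{1}{\deg(i)}\sum_j a_{i,j}\beta_j$ and $F_i(\beta)=f(\mu_i(\beta),\gamma_i)$. Dynamics: $\beta_i(1)\in(0,1)$ are given initial values. For each $t\ge1$, conditionally on the history $\mathcal{H}_t$ (all declarations up to time $t$), the declarations $\psi_{i,t+1}\in\{0,1\}$, $i=1,\dots,n$, are independent with $\mathbb{P}[\psi_{i,t+1}=1\mid\mathcal{H}_t]=f(\mu_i(\beta(t)),\gamma_i)$, and $\beta_i(t+1)=\frac{t}{t+1}\beta_i(t)+\frac{1}{t+1}\psi_{i,t+1}$. *)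

theory Defs
  imports "HOL-Probability.Probability"
begin

text \<open>Bias function f(mu, gamma) = gamma mu / (1 + (gamma - 1) mu).\<close>
definition fbias :: "real \<Rightarrow> real \<Rightarrow> real" where
  "fbias \<mu> \<gamma> = \<gamma> * \<mu> / (1 + (\<gamma> - 1) * \<mu>)"

text \<open>Weighted degree of agent i.\<close>
definition deg :: "('n::finite \<Rightarrow> 'n \<Rightarrow> real) \<Rightarrow> 'n \<Rightarrow> real" where
  "deg a i = (\<Sum>j\<in>UNIV. a i j)"

text \<open>Neighbourhood average mu_i(beta).\<close>
definition mu :: "('n::finite \<Rightarrow> 'n \<Rightarrow> real) \<Rightarrow> ('n \<Rightarrow> real) \<Rightarrow> 'n \<Rightarrow> real" where
  "mu a \<beta> i = (\<Sum>j\<in>UNIV. a i j * \<beta> j) / deg a i"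

text \<open>The map F.\<close>
definition Fmap :: "('n::finite \<Rightarrow> 'n \<Rightarrow> real) \<Rightarrow> ('n \<Rightarrow> real) \<Rightarrow> ('n \<Rightarrow> real) \<Rightarrow> 'n \<Rightarrow> real" where
  "Fmap a \<gamma> \<beta> i = fbias (mu a \<beta> i) (\<gamma> i)"

text \<open>Edge relation of the graph: {i,j} is an edge iff a i j > 0 (self-loops allowed).\<close>
definition graph_connected :: "('n \<Rightarrow> 'n \<Rightarrow> real) \<Rightarrow> bool" where
  "graph_connected a \<longleftrightarrow> (\<forall>i j. (i, j) \<in> {(x, y). a x y > 0}\<^sup>*)"

definition graph_bipartite :: "('n \<Rightarrow> 'n \<Rightarrow> real) \<Rightarrow> bool" where
  "graph_bipartite a \<longleftrightarrow> (\<exists>c :: 'n \<Rightarrow> bool. \<forall>i j. a i j > 0 \<longrightarrow> c i \<noteq> c j)"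

text \<open>Opinion process: beta(1) = b1 and
  beta(t+1) = t/(t+1) beta(t) + 1/(t+1) psi(t+1), for t >= 1.
  Time 0 is unused (set to b1 for definiteness).\<close>
fun beta :: "(nat \<Rightarrow> 'n \<Rightarrow> 'w \<Rightarrow> bool) \<Rightarrow> ('n \<Rightarrow> real) \<Rightarrow> nat \<Rightarrow> 'w \<Rightarrow> 'n \<Rightarrow> real" where
  "beta \<psi> b1 0 \<omega> = b1"
| "beta \<psi> b1 (Suc 0) \<omega> = b1"
| "beta \<psi> b1 (Suc (Suc k)) \<omega> =
     (\<lambda>i. real (Suc k) / real (Suc (Suc k)) * beta \<psi> b1 (Suc k) \<omega> i
          + 1 / real (Suc (Suc k)) * (if \<psi> (Suc (Suc k)) i \<omega> then 1 else 0))"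

text \<open>History H_t: sigma-algebra generated by all declarations psi s i with 2 <= s <= t.\<close>
definition history :: "'w measure \<Rightarrow> (nat \<Rightarrow> 'n \<Rightarrow> 'w \<Rightarrow> bool) \<Rightarrow> nat \<Rightarrow> 'w measure" where
  "history M \<psi> t = sigma (space M)
     {(\<psi> s i) -` {True} \<inter> space M | s i. 2 \<le> s \<and> s \<le> t}"

end

theory Submission
  imports Defs
begin

text \<open>The mean dynamics is a gradient-like ascent of the potential
  \<open>\<Phi>(\<beta>) = 1/2 \<Sum> a\<^sub>i\<^sub>j \<beta>\<^sub>i \<beta>\<^sub>j - \<Sum> deg(i) g\<^sub>i(\<beta>\<^sub>i)\<close> with \<open>g\<^sub>i' = f(\<cdot>, 1/\<gamma>\<^sub>i)\<close>, the inverse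
  of \<open>f(\<cdot>, \<gamma>\<^sub>i)\<close>: the i-th partial derivative \<open>deg(i) (\<mu>\<^sub>i - f(\<beta>\<^sub>i, 1/\<gamma>\<^sub>i))\<close> has the sign of
  \<open>F\<^sub>i - \<beta>\<^sub>i\<close>. As \<open>\<Phi>\<close> is bounded and the steps are of order 1/t, the expectations of
  \<open>Q(\<beta>(t)) / (t + 1)\<close> are summable, where \<open>Q = \<nabla>\<Phi> \<cdot> (F - \<beta>) \<ge> 0\<close> vanishes exactly at the fixed
  points; so the series \<open>\<Sum> Q(\<beta>(t)) / (t + 1)\<close> converges almost surely. The rest is pathwise.
  Since \<open>\<beta>\<close> moves slowly, every cluster point is a fixed point, and convergence follows once the
  cluster points are isolated. Fixed points are 0, 1, or interior. For interior fixed points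
  p and q put \<open>w\<^sub>i = q\<^sub>i (1 - p\<^sub>i)\<close> and \<open>y\<^sub>i = (q\<^sub>i - p\<^sub>i) / w\<^sub>i\<close>; then
  \<open>\<Sum>\<^sub>j a\<^sub>i\<^sub>j w\<^sub>j (y\<^sub>j - y\<^sub>i) = C\<^sub>i y\<^sub>i\<close> with \<open>C\<^sub>i\<close> the covariance of p and q over the
  neighbours of i. For q near p all \<open>C\<^sub>i\<close> are nonnegative and, by non-bipartiteness and since not
  all \<open>\<gamma>\<^sub>i\<close> are 1, one of them is positive, so the maximum principle gives q = p.\<close>

section \<open>Slowly varying sequences\<close>

text \<open>A sequence that returns close to p without converging to p keeps leaving a small ball
  around p. Its late steps are too short to jump over the shell between the radii
  \<open>d / 2\<close> and \<open>d\<close>, so compactness gives a second cluster point inside that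
  shell.\<close>

lemma slowly_varying_converges_to_isolated_cluster_point:
  fixes x :: "nat \<Rightarrow> 'a::heine_borel"
  assumes bdd: "bounded (range x)"
    and step: "(\<lambda>n. dist (x (Suc n)) (x n)) \<longlonglongrightarrow> 0"
    and r: "strict_mono r" "(x \<circ> r) \<longlonglongrightarrow> p"
    and e: "e > 0"
    and isolated: "\<And>s q. strict_mono s \<Longrightarrow> (x \<circ> s) \<longlonglongrightarrow> q \<Longrightarrow> dist q p < e \<Longrightarrow> q = p"
  shows "x \<longlonglongrightarrow> p"
proof (rule ccontr)
  assume "\<not> x \<longlonglongrightarrow> p"
  then obtain d0 where "d0 > 0" and d0: "\<And>N. \<exists>n\<ge>N. d0 \<le> dist (x n) p"
    by (fastforce simp: LIMSEQ_def not_less)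
  \<comment> \<open>The bound \<open>e / 2\<close> puts the whole closed shell inside the ball of
    radius \<open>e\<close>, where p is the only cluster point.\<close>
  define d where "d = min d0 (e / 2)"
  have d: "d > 0" "d < e" using \<open>d0 > 0\<close> e by (auto simp: d_def)
  have far: "\<exists>n\<ge>N. d \<le> dist (x n) p" for N
    using d0[of N] by (auto simp: d_def intro: min.coboundedI1)
  obtain N0 where N0: "\<And>n. n \<ge> N0 \<Longrightarrow> dist (x (Suc n)) (x n) < d / 2"
    using step d unfolding LIMSEQ_def
    by (metis abs_of_nonneg diff_zero dist_real_def half_gt_zero zero_le_dist)
  obtain K where K: "\<And>k. k \<ge> K \<Longrightarrow> dist (x (r k)) p < d / 2"
    using r(2) d unfolding LIMSEQ_def by (metis comp_apply half_gt_zero)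
  let ?A = "{y. d / 2 \<le> dist y p \<and> dist y p \<le> d}"
  have "\<exists>m\<ge>N. x m \<in> ?A" for N
  proof -
    define n where "n = r (max K (max N N0))"
    have "n \<ge> max K (max N N0)" unfolding n_def by (rule seq_suble[OF r(1)])
    then have n: "n \<ge> N" "n \<ge> N0" by auto
    have near: "dist (x n) p < d / 2" unfolding n_def by (rule K) simp
    define P where "P m \<longleftrightarrow> n \<le> m \<and> d / 2 \<le> dist (x m) p" for m
    obtain m' where "n \<le> m'" "d \<le> dist (x m') p" using far[of n] by blast
    then have "P m'" using d(1) by (simp add: P_def)
    \<comment> \<open>The first exit after \<open>n\<close> from the ball of radius
      \<open>d / 2\<close>: the preceding point is still inside and the step is shorter than
      \<open>d / 2\<close>, so \<open>x m\<close> lies in the shell.\<close>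
    define m where "m = (LEAST m. P m)"
    have "P m" unfolding m_def by (rule LeastI[of P, OF \<open>P m'\<close>])
    then have m: "n \<le> m" "d / 2 \<le> dist (x m) p" by (simp_all add: P_def)
    have least: "m \<le> k" if "n \<le> k" "d / 2 \<le> dist (x k) p" for k
      unfolding m_def using that by (intro Least_le) (simp add: P_def)
    have "m \<noteq> n" using near m(2) by auto
    then obtain k where k: "m = Suc k" "n \<le> k"
      using m(1) by (cases m) auto
    have "dist (x k) p < d / 2" using least[of k] k by force
    moreover have "dist (x m) p \<le> dist (x m) (x k) + dist (x k) p" by (rule dist_triangle)
    moreover have "dist (x m) (x k) < d / 2" using N0[of k] n k by simp
    ultimately show ?thesis using m n by (intro exI[of _ m]) auto
  qed
  then have inf: "infinite {m. x m \<in> ?A}"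
    by (metis (mono_tags, lifting) infinite_nat_iff_unbounded_le mem_Collect_eq)
  define s where "s = enumerate {m. x m \<in> ?A}"
  have s: "strict_mono s" "\<And>k. x (s k) \<in> ?A"
    using inf strict_mono_enumerate enumerate_in_set unfolding s_def by blast+
  have "bounded (range (x \<circ> s))" by (rule bounded_subset[OF bdd]) auto
  then obtain l q where l: "strict_mono (l :: nat \<Rightarrow> nat)" "((x \<circ> s) \<circ> l) \<longlonglongrightarrow> q"
    using bounded_imp_convergent_subsequence by blast
  have lim: "(\<lambda>k. dist (((x \<circ> s) \<circ> l) k) p) \<longlonglongrightarrow> dist q p" by (intro tendsto_intros l)
  have "d / 2 \<le> dist q p"
    by (rule LIMSEQ_le_const[OF lim]) (use s(2) in auto)
  moreover have "dist q p \<le> d"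
    by (rule LIMSEQ_le_const2[OF lim]) (use s(2) in auto)
  moreover have "q = p"
  proof (rule isolated)
    show "strict_mono (s \<circ> l)" using s l strict_mono_o by blast
    show "(x \<circ> (s \<circ> l)) \<longlonglongrightarrow> q" using l by (simp add: comp_assoc)
    show "dist q p < e" using calculation d by simp
  qed
  ultimately show False using d by simp
qed

text \<open>With steps of order 1/n, a visit near a point where \<open>\<phi>\<close> is positive lasts from time n
  to time (1 + c) n, which contributes a fixed amount to the series.\<close>

lemma weighted_summable_imp_zero_at_cluster_point:
  fixes x :: "nat \<Rightarrow> 'a::metric_space" and \<phi> :: "'a \<Rightarrow> real"
  assumes step: "\<And>n. dist (x (Suc n)) (x n) \<le> C / real (Suc n)"
    and cont: "continuous_on S \<phi>" and xS: "\<And>n. x n \<in> S" and pS: "p \<in> S"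
    and nonneg: "\<And>y. y \<in> S \<Longrightarrow> 0 \<le> \<phi> y"
    and summ: "summable (\<lambda>n. \<phi> (x n) / real (Suc n))"
    and r: "strict_mono r" "(x \<circ> r) \<longlonglongrightarrow> p"
  shows "\<phi> p = 0"
proof (rule ccontr)
  assume "\<phi> p \<noteq> 0"
  then have pos: "\<phi> p > 0" using nonneg[OF pS] by simp
  define q where "q = \<phi> p / 2"
  have q: "q > 0" using pos by (simp add: q_def)
  obtain d where d: "d > 0" and "\<And>y. y \<in> S \<Longrightarrow> dist y p < d \<Longrightarrow> dist (\<phi> y) (\<phi> p) < q"
    using cont pS q unfolding continuous_on_iff by blast
  then have near: "\<phi> y \<ge> q" if "y \<in> S" "dist y p < d" for y
    using that by (fastforce simp: dist_real_def q_def abs_if split: if_splits)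
  have C: "C \<ge> 0" using order_trans[OF zero_le_dist step[of 0]] by simp
  \<comment> \<open>With \<open>C * c \<le> d / 2\<close>, at most \<open>c * n\<close> steps of
    length at most \<open>C / n\<close> stay within \<open>d / 2\<close> of \<open>x n\<close>. The
    cap 1 keeps all indices of the block at most \<open>2 * n\<close>.\<close>
  define c where "c = min 1 (d / (2 * (C + 1)))"
  have c: "c > 0" "c \<le> 1" using d C by (auto simp: c_def)
  have cC: "C * c \<le> d / 2"
  proof -
    have "C * c \<le> C * (d / (2 * (C + 1)))" by (intro mult_left_mono) (auto simp: c_def C)
    also have "\<dots> \<le> d / 2" using C d by (simp add: field_simps)
    finally show ?thesis .
  qed
  \<comment> \<open>The block starting at \<open>n\<close> will have \<open>m + 1 > c * n\<close>
    terms of size at least \<open>q / (4 * n)\<close>, hence a sum of at least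
    \<open>q * c / 4\<close>.\<close>
  obtain N where N: "\<And>m n. m \<ge> N \<Longrightarrow> norm (\<Sum>k=m..<n. \<phi> (x k) / real (Suc k)) < q * c / 4"
    using summ q c unfolding summable_Cauchy by (metis divide_pos_pos mult_pos_pos zero_less_numeral)
  obtain K where K: "\<And>k. k \<ge> K \<Longrightarrow> dist (x (r k)) p < d / 2"
    using r(2) d unfolding LIMSEQ_def by (metis comp_apply half_gt_zero)
  obtain n where n: "n \<ge> N" "n \<ge> 1" "dist (x n) p < d / 2"
  proof
    let ?n = "r (max K (max N 1))"
    have "?n \<ge> max K (max N 1)" by (rule seq_suble[OF r(1)])
    then show "?n \<ge> N" "?n \<ge> 1" by auto
    show "dist (x ?n) p < d / 2" by (rule K) simp
  qed
  define m where "m = nat \<lfloor>c * real n\<rfloor>"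
  have m: "real m \<le> c * real n" "c * real n < real m + 1"
    using c by (auto simp: m_def)
  have drift: "dist (x (n + k)) (x n) \<le> real k * (C / real n)" for k
  proof (induction k)
    case (Suc k)
    have "dist (x (n + Suc k)) (x n) \<le> dist (x (Suc (n + k))) (x (n + k)) + dist (x (n + k)) (x n)"
      using dist_triangle by simp
    also have "\<dots> \<le> C / real (Suc (n + k)) + real k * (C / real n)"
      by (intro add_mono step Suc.IH)
    also have "C / real (Suc (n + k)) \<le> C / real n" using C n by (intro divide_left_mono) auto
    finally show ?case by (simp add: algebra_simps add_divide_distrib)
  qed simp
  have visit: "\<phi> (x k) \<ge> q" if k: "k \<in> {n..<n + m + 1}" for k
  proof (rule near[OF xS])
    obtain j where j: "k = n + j" "j \<le> m" using k by (intro that[of "k - n"]) auto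
    have "dist (x k) (x n) \<le> real j * (C / real n)" using drift j by simp
    also have "\<dots> \<le> real m * (C / real n)" using j C by (intro mult_right_mono) auto
    also have "\<dots> \<le> (c * real n) * (C / real n)" using m C by (intro mult_right_mono) auto
    also have "\<dots> \<le> d / 2" using cC n by (simp add: mult.commute)
    finally show "dist (x k) p < d"
      using dist_triangle[of "x k" p "x n"] n(3) by simp
  qed
  have "q * c / 4 \<le> (real m + 1) * (q / (4 * real n))"
  proof -
    have "q * c / 4 = (c * real n) * (q / (4 * real n))" using n by simp
    also have "\<dots> \<le> (real m + 1) * (q / (4 * real n))" using m q by (intro mult_right_mono) auto
    finally show ?thesis .
  qed
  also have "\<dots> = (\<Sum>k=n..<n + m + 1. q / (4 * real n))" by simp
  also have "\<dots> \<le> (\<Sum>k=n..<n + m + 1. \<phi> (x k) / real (Suc k))"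
  proof (rule sum_mono)
    fix k assume k: "k \<in> {n..<n + m + 1}"
    have "c * real n \<le> real n" using c by (simp add: mult_left_le_one_le)
    then have "real m \<le> real n" using m by simp
    then have "real (Suc k) \<le> 4 * real n" using k n by auto
    then show "q / (4 * real n) \<le> \<phi> (x k) / real (Suc k)"
      using visit[OF k] q n by (intro frac_le) auto
  qed
  also have "\<dots> < q * c / 4" using N[OF n(1), of "n + m + 1"] unfolding real_norm_def by linarith
  finally show False by simp
qed

section \<open>The bias function\<close>

text \<open>The denominator is the convex combination of 1 and \<open>g\<close> with weights
  \<open>1 - x\<close> and \<open>x\<close>.\<close>

lemma fbias_denom_pos:
  fixes g x :: real
  assumes "0 < g" "0 \<le> x" "x \<le> 1" shows "0 < 1 + (g - 1) * x"
proof (cases "x = 1")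
  case False
  have "1 + (g - 1) * x = (1 - x) + g * x" by (simp add: left_diff_distrib)
  also have "\<dots> > 0" using assms False by (intro add_pos_nonneg) auto
  finally show ?thesis .
qed (use assms in simp)

lemma fbias_denom_inverse_pos:
  fixes g x :: real
  assumes "0 < g" "0 \<le> x" "x \<le> 1" shows "0 < g + (1 - g) * x"
proof -
  have "g + (1 - g) * x = 1 + (g - 1) * (1 - x)" by (simp add: algebra_simps)
  then show ?thesis using fbias_denom_pos[of g "1 - x"] assms by simp
qed

lemma fbias_inverse: "0 < g \<Longrightarrow> fbias x (1 / g) = x / (g + (1 - g) * x)"
proof -
  assume g: "0 < g"
  have "fbias x (1 / g) = (x / g) / ((g + (1 - g) * x) / g)"
    using g by (simp add: fbias_def field_simps)
  then show ?thesis using g by simp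
qed

lemma one_minus_fbias:
  assumes "0 < g" "0 \<le> x" "x \<le> 1"
  shows "1 - fbias x g = (1 - x) / (1 + (g - 1) * x)"
  using fbias_denom_pos[OF assms] by (simp add: fbias_def divide_simps) (simp add: algebra_simps)

lemma fbias_range:
  assumes "0 < g" "0 \<le> x" "x \<le> 1"
  shows "0 \<le> fbias x g" "fbias x g \<le> 1"
proof -
  show "0 \<le> fbias x g" unfolding fbias_def using fbias_denom_pos[OF assms] assms by simp
  have "0 \<le> 1 - fbias x g" unfolding one_minus_fbias[OF assms]
    using fbias_denom_pos[OF assms] assms by simp
  then show "fbias x g \<le> 1" by simp
qed

lemma fbias_diff:
  assumes "0 < g" "0 \<le> x" "x \<le> 1" "0 \<le> y" "y \<le> 1"
  shows "fbias x g - fbias y g = g * (x - y) / ((1 + (g - 1) * x) * (1 + (g - 1) * y))"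
  using fbias_denom_pos[of g x] fbias_denom_pos[of g y] assms
  by (simp add: fbias_def divide_simps) (simp add: algebra_simps)

text \<open>Both differences are residuals of the same equation, solved once for y and once for x.
  The factor between them is a quotient of positive denominators, which is what aligns the drift
  with the gradient of the potential.\<close>

lemma fbias_minus_eq:
  assumes g: "0 < g" and "0 \<le> x" "x \<le> 1" "0 \<le> y" "y \<le> 1"
  shows "fbias x g - y = (x - fbias y (1 / g)) * ((g + (1 - g) * y) / (1 + (g - 1) * x))"
  unfolding fbias_inverse[OF g]
  using fbias_denom_pos[of g x] fbias_denom_inverse_pos[of g y] assms
  by (simp add: fbias_def divide_simps) (simp add: algebra_simps)

lemma fbias_eq_self_imp_unbiased:
  assumes "0 < g" "0 < x" "x < 1" "fbias x g = x" shows "g = 1"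
proof -
  have "g * x = x * (1 + (g - 1) * x)"
    using assms fbias_denom_pos[of g x] by (simp add: fbias_def field_simps)
  then have "x * ((g - 1) * (1 - x)) = 0" by (simp add: algebra_simps)
  then show ?thesis using assms by simp
qed

text \<open>Both factors of the denominator in \<open>fbias_diff\<close> are convex combinations of
  1 and \<open>g\<close>, hence at least \<open>min 1 g\<close>.\<close>

lemma fbias_lipschitz:
  assumes "0 < g" "0 \<le> x" "x \<le> 1" "0 \<le> y" "y \<le> 1"
  shows "\<bar>fbias x g - fbias y g\<bar> \<le> g / (min 1 g)\<^sup>2 * \<bar>x - y\<bar>"
proof -
  have m: "min 1 g \<le> 1 + (g - 1) * z" if "0 \<le> z" "z \<le> 1" for z
  proof -
    have "min 1 g = (1 - z) * min 1 g + z * min 1 g" by (simp add: algebra_simps)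
    also have "\<dots> \<le> (1 - z) * 1 + z * g"
      using that by (intro add_mono mult_left_mono) auto
    finally show ?thesis by (simp add: algebra_simps)
  qed
  have "(min 1 g)\<^sup>2 \<le> (1 + (g - 1) * x) * (1 + (g - 1) * y)"
    unfolding power2_eq_square using assms m fbias_denom_pos[of g x] by (intro mult_mono) auto
  moreover have "\<bar>fbias x g - fbias y g\<bar> = g * \<bar>x - y\<bar> / ((1 + (g - 1) * x) * (1 + (g - 1) * y))"
    unfolding fbias_diff[OF assms] using assms fbias_denom_pos[of g x] fbias_denom_pos[of g y]
    by (simp add: abs_mult)
  moreover have "0 < (min 1 g)\<^sup>2" using assms by simp
  ultimately show ?thesis
    using assms by (simp add: frac_le)
qed

section \<open>An antiderivative of the inverse bias function\<close>

definition fbias_inverse_antideriv :: "real \<Rightarrow> real \<Rightarrow> real" where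
  "fbias_inverse_antideriv g x =
     (if g = 1 then x\<^sup>2 / 2 else x / (1 - g) - g / (1 - g)\<^sup>2 * ln (g + (1 - g) * x))"

text \<open>The argument of the logarithm is positive on the closed unit interval, so the derivative
  is two-sided at 0 and 1 as well. The case \<open>g = 1\<close> stands apart because the
  logarithmic formula divides by \<open>1 - g\<close>.\<close>

lemma DERIV_fbias_inverse_antideriv:
  assumes g: "0 < g" and x: "0 \<le> x" "x \<le> 1"
  shows "(fbias_inverse_antideriv g has_real_derivative fbias x (1 / g)) (at x)"
proof (cases "g = 1")
  case True
  have "((\<lambda>x. x\<^sup>2 / 2) has_real_derivative x) (at x)"
    by (auto intro!: derivative_eq_intros)
  then show ?thesis using True by (simp add: fbias_inverse_antideriv_def[abs_def] fbias_def)
next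
  case False
  have pos: "0 < g + (1 - g) * x" by (rule fbias_denom_inverse_pos[OF assms])
  have "((\<lambda>x. x / (1 - g) - g / (1 - g)\<^sup>2 * ln (g + (1 - g) * x)) has_real_derivative
      1 / (1 - g) - g / (1 - g)\<^sup>2 * ((1 - g) / (g + (1 - g) * x))) (at x)"
    using pos False by (auto intro!: derivative_eq_intros simp: power2_eq_square)
  moreover have "1 / (1 - g) - g / (1 - g)\<^sup>2 * ((1 - g) / (g + (1 - g) * x)) = x / (g + (1 - g) * x)"
  proof -
    have "1 / c - g / c\<^sup>2 * (c / (g + c * x)) = x / (g + c * x)"
      if "c \<noteq> 0" "0 < g + c * x" for c
      using that by (simp add: power2_eq_square divide_simps)
    from this[of "1 - g"] show ?thesis using False pos by simp
  qed
  ultimately show ?thesis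
    using False by (simp add: fbias_inverse_antideriv_def[abs_def] fbias_inverse[OF g])
qed

lemma fbias_inverse_antideriv_mvt:
  assumes g: "0 < g" and "0 \<le> x" "x \<le> 1" "0 \<le> y" "y \<le> 1"
  obtains z where "0 \<le> z" "z \<le> 1" "\<bar>z - x\<bar> \<le> \<bar>y - x\<bar>"
    "fbias_inverse_antideriv g y - fbias_inverse_antideriv g x = fbias z (1 / g) * (y - x)"
proof -
  consider "x < y" | "x = y" | "y < x" by linarith
  then show thesis
  proof cases
    case 1
    obtain z where "x < z" "z < y" "fbias_inverse_antideriv g y - fbias_inverse_antideriv g x = (y - x) * fbias z (1 / g)"
      using MVT2[OF 1, of "fbias_inverse_antideriv g" "\<lambda>z. fbias z (1 / g)"]
        DERIV_fbias_inverse_antideriv[OF g] assms by (metis order_trans)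
    then show thesis using assms by (intro that[of z]) (auto simp: mult.commute)
  next
    case 2
    then show thesis using assms by (intro that[of x]) auto
  next
    case 3
    obtain z where "y < z" "z < x" "fbias_inverse_antideriv g x - fbias_inverse_antideriv g y = (x - y) * fbias z (1 / g)"
      using MVT2[OF 3, of "fbias_inverse_antideriv g" "\<lambda>z. fbias z (1 / g)"]
        DERIV_fbias_inverse_antideriv[OF g] assms by (metis order_trans)
    then show thesis using assms by (intro that[of z]) (auto simp: algebra_simps)
  qed
qed

text \<open>The mean value theorem gives the slope at an intermediate point, and the Lipschitz bound
  for \<open>fbias\<close> with parameter \<open>1 / g\<close> compares it with the slope at
  x.\<close>

lemma fbias_inverse_antideriv_upper:
  assumes g: "0 < g" and xy: "0 \<le> x" "x \<le> 1" "0 \<le> y" "y \<le> 1"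
  shows "fbias_inverse_antideriv g y - fbias_inverse_antideriv g x
    \<le> fbias x (1 / g) * (y - x) + (1 / g) / (min 1 (1 / g))\<^sup>2 * (y - x)\<^sup>2"
proof -
  obtain z where z: "0 \<le> z" "z \<le> 1" "\<bar>z - x\<bar> \<le> \<bar>y - x\<bar>"
    "fbias_inverse_antideriv g y - fbias_inverse_antideriv g x = fbias z (1 / g) * (y - x)"
    using fbias_inverse_antideriv_mvt[OF assms] by metis
  let ?L = "(1 / g) / (min 1 (1 / g))\<^sup>2"
  have L: "0 \<le> ?L" using g by simp
  have "(fbias z (1 / g) - fbias x (1 / g)) * (y - x) \<le> \<bar>fbias z (1 / g) - fbias x (1 / g)\<bar> * \<bar>y - x\<bar>"
    by (simp add: abs_mult[symmetric])
  also have "\<dots> \<le> (?L * \<bar>z - x\<bar>) * \<bar>y - x\<bar>"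
    using fbias_lipschitz[of "1 / g" z x] g xy z by (intro mult_right_mono) auto
  also have "\<dots> \<le> (?L * \<bar>y - x\<bar>) * \<bar>y - x\<bar>"
    using z(3) L by (intro mult_right_mono mult_left_mono) auto
  also have "\<dots> = ?L * (y - x)\<^sup>2" by (metis abs_mult_self_eq mult.assoc power2_eq_square)
  finally show ?thesis using z(4) by (simp add: algebra_simps)
qed

text \<open>The slope lies between 0 and 1. The value at 0 is subtracted because for
  \<open>g \<noteq> 1\<close> the antiderivative does not vanish there.\<close>

lemma fbias_inverse_antideriv_bounded:
  assumes g: "0 < g" and x: "0 \<le> x" "x \<le> 1"
  shows "\<bar>fbias_inverse_antideriv g x - fbias_inverse_antideriv g 0\<bar> \<le> 1"
proof -
  obtain z where z: "0 \<le> z" "z \<le> 1"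
    "fbias_inverse_antideriv g x - fbias_inverse_antideriv g 0 = fbias z (1 / g) * (x - 0)"
    using fbias_inverse_antideriv_mvt[of g 0 x] assms by (metis order_refl zero_le_one)
  then show ?thesis
    using fbias_range[of "1 / g" z] g x by (auto simp: abs_mult intro!: mult_le_one)
qed

section \<open>The potential of the mean dynamics\<close>

definition in_cube :: "('n \<Rightarrow> real) \<Rightarrow> bool" where
  "in_cube b \<longleftrightarrow> (\<forall>i. 0 \<le> b i \<and> b i \<le> 1)"

locale bias_network =
  fixes a :: "'n::finite \<Rightarrow> 'n \<Rightarrow> real" and \<gamma> :: "'n \<Rightarrow> real"
  assumes sym: "\<And>i j. a i j = a j i"
    and nonneg: "\<And>i j. a i j \<ge> 0"
    and conn: "graph_connected a"
    and nonbip: "\<not> graph_bipartite a"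
    and gpos: "\<And>i. \<gamma> i > 0"
    and gnot1: "\<exists>i. \<gamma> i \<noteq> 1"
begin

text \<open>Induction along a path: connectedness makes every agent reachable from
  \<open>i\<close>.\<close>

lemma propagate:
  assumes "P i" and step: "\<And>x y. P x \<Longrightarrow> a x y > 0 \<Longrightarrow> P y"
  shows "P j"
proof -
  have "(i, j) \<in> {(x, y). a x y > 0}\<^sup>*" using conn by (auto simp: graph_connected_def)
  then show ?thesis
  proof (induction rule: rtrancl_induct)
    case (step x y)
    then show ?case using assms(2)[of x y] by simp
  qed fact
qed

text \<open>An agent without neighbours reaches only itself, so by connectedness it is the only
  agent; a graph without edges is bipartite.\<close>

lemma exists_neighbour: "\<exists>j. a i j > 0"
proof (rule ccontr)
  assume none: "\<nexists>j. a i j > 0"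
  have "x = i" for x by (rule propagate[of "\<lambda>x. x = i" i]) (use none in blast)+
  then have "\<not> a x y > 0" for x y using none by metis
  then have "graph_bipartite a" by (simp add: graph_bipartite_def)
  then show False using nonbip by simp
qed

lemma deg_pos: "0 < deg a i"
proof -
  obtain j where "a i j > 0" using exists_neighbour by blast
  then show ?thesis unfolding deg_def by (intro sum_pos2[of _ j]) (simp_all add: nonneg)
qed

lemma deg_mu: "deg a i * mu a b i = (\<Sum>j\<in>UNIV. a i j * b j)"
  using deg_pos[of i] by (simp add: mu_def)

lemma deg_mu_complement: "deg a i * (1 - mu a b i) = (\<Sum>j\<in>UNIV. a i j * (1 - b j))"
  using deg_mu[of i b] by (simp add: algebra_simps sum_subtractf deg_def)

lemma mu_nonneg: "in_cube b \<Longrightarrow> 0 \<le> mu a b i"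
  unfolding mu_def in_cube_def using deg_pos[of i] nonneg by (auto intro!: divide_nonneg_pos sum_nonneg)

lemma mu_le_1:
  assumes "in_cube b" shows "mu a b i \<le> 1"
proof -
  have "0 \<le> deg a i * (1 - mu a b i)"
    unfolding deg_mu_complement using assms nonneg by (auto simp: in_cube_def intro!: sum_nonneg)
  then show ?thesis using deg_pos[of i] by (simp add: zero_le_mult_iff)
qed

lemma Fmap_range: "in_cube b \<Longrightarrow> 0 \<le> Fmap a \<gamma> b i \<and> Fmap a \<gamma> b i \<le> 1"
  unfolding Fmap_def using fbias_range mu_nonneg mu_le_1 gpos by simp

section \<open>Potential, gradient and rate of ascent\<close>

definition potential :: "('n \<Rightarrow> real) \<Rightarrow> real" where
  "potential b = (\<Sum>i\<in>UNIV. \<Sum>j\<in>UNIV. a i j * b i * b j) / 2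
     - (\<Sum>i\<in>UNIV. deg a i * fbias_inverse_antideriv (\<gamma> i) (b i))"

definition gradient :: "('n \<Rightarrow> real) \<Rightarrow> 'n \<Rightarrow> real" where
  "gradient b i = deg a i * (mu a b i - fbias (b i) (1 / \<gamma> i))"

definition ascent :: "('n \<Rightarrow> real) \<Rightarrow> real" where
  "ascent b = (\<Sum>i\<in>UNIV. gradient b i * (Fmap a \<gamma> b i - b i))"

text \<open>The factor of \<open>fbias_minus_eq\<close> divided by the degree. It varies with
  \<open>b\<close> and \<open>i\<close>, but its sign suffices: every term of \<open>ascent\<close>
  is a positive multiple of a squared gradient entry.\<close>

lemma gradient_mult_drift:
  assumes "in_cube b"
  obtains c where "c > 0" "Fmap a \<gamma> b i - b i = c * gradient b i"
proof
  let ?c = "(\<gamma> i + (1 - \<gamma> i) * b i) / (1 + (\<gamma> i - 1) * mu a b i) / deg a i"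
  show "?c > 0"
    using assms fbias_denom_pos[OF gpos mu_nonneg[OF assms] mu_le_1[OF assms]]
      fbias_denom_inverse_pos[OF gpos] deg_pos by (auto simp: in_cube_def)
  show "Fmap a \<gamma> b i - b i = ?c * gradient b i"
    unfolding Fmap_def gradient_def
    using assms deg_pos[of i]
      fbias_minus_eq[OF gpos mu_nonneg[OF assms] mu_le_1[OF assms], of "b i" i]
    by (simp add: in_cube_def)
qed

lemma ascent_term_nonneg:
  assumes "in_cube b" shows "0 \<le> gradient b i * (Fmap a \<gamma> b i - b i)"
proof -
  obtain c where "c > 0" and c: "Fmap a \<gamma> b i - b i = c * gradient b i"
    using gradient_mult_drift[OF assms] .
  then show ?thesis unfolding c by (simp add: mult.left_commute[of _ c])
qed

lemma ascent_nonneg: "in_cube b \<Longrightarrow> 0 \<le> ascent b"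
  unfolding ascent_def by (intro sum_nonneg ascent_term_nonneg)

lemma ascent_eq_0D:
  assumes "in_cube b" "ascent b = 0" shows "Fmap a \<gamma> b = b"
proof
  fix i
  have "gradient b i * (Fmap a \<gamma> b i - b i) = 0"
    using assms ascent_term_nonneg unfolding ascent_def by (subst (asm) sum_nonneg_eq_0_iff) auto
  moreover obtain c where "c > 0" "Fmap a \<gamma> b i - b i = c * gradient b i"
    using gradient_mult_drift[OF assms(1)] .
  ultimately show "Fmap a \<gamma> b i = b i" by auto
qed

text \<open>A bound for the second-order loss per unit of \<open>h\<^sup>2\<close>: half the total
  weight controls the quadratic form, and the Lipschitz constants of the inverse bias functions
  control the separable part.\<close>

definition curvature :: real where
  "curvature = (\<Sum>i\<in>UNIV. \<Sum>j\<in>UNIV. a i j) / 2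
     + (\<Sum>i\<in>UNIV. deg a i * ((1 / \<gamma> i) / (min 1 (1 / \<gamma> i))\<^sup>2))"

text \<open>A Taylor bound for a move of at most \<open>h\<close> per coordinate: the quadratic form
  is expanded exactly, the separable part is estimated by
  \<open>fbias_inverse_antideriv_upper\<close>.\<close>

lemma potential_lower:
  assumes b: "in_cube b" and b': "in_cube b'" and h: "\<And>i. \<bar>b' i - b i\<bar> \<le> h"
  shows "potential b + (\<Sum>i\<in>UNIV. gradient b i * (b' i - b i)) - curvature * h\<^sup>2 \<le> potential b'"
proof -
  define d where "d i = b' i - b i" for i
  define L where "L i = (1 / \<gamma> i) / (min 1 (1 / \<gamma> i))\<^sup>2" for i
  have b'_eq: "b' i = b i + d i" for i by (simp add: d_def)
  have L: "0 \<le> L i" for i using gpos[of i] by (simp add: L_def)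
  have h0: "0 \<le> h" using h abs_ge_zero order_trans by blast
  have d2: "(d i)\<^sup>2 \<le> h\<^sup>2" for i using h by (simp add: d_def abs_le_square_iff[symmetric] h0)
  have cross: "(\<Sum>i\<in>UNIV. \<Sum>j\<in>UNIV. a i j * (d i * d j)) \<ge> - ((\<Sum>i\<in>UNIV. \<Sum>j\<in>UNIV. a i j) * h\<^sup>2)"
  proof -
    have "- (a i j * h\<^sup>2) \<le> a i j * (d i * d j)" for i j
    proof -
      have "\<bar>d i * d j\<bar> \<le> h * h" unfolding abs_mult using h h0 by (intro mult_mono) (auto simp: d_def)
      then have "- (h\<^sup>2) \<le> d i * d j" by (simp add: power2_eq_square)
      then have "a i j * (- (h\<^sup>2)) \<le> a i j * (d i * d j)" by (intro mult_left_mono nonneg)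
      then show ?thesis by simp
    qed
    then show ?thesis
      unfolding sum_distrib_right sum_negf[symmetric] by (intro sum_mono)
  qed
  have "(\<Sum>i\<in>UNIV. \<Sum>j\<in>UNIV. a i j * b' i * b' j) - (\<Sum>i\<in>UNIV. \<Sum>j\<in>UNIV. a i j * b i * b j)
      = (\<Sum>i\<in>UNIV. \<Sum>j\<in>UNIV. a i j * b j * d i) + (\<Sum>i\<in>UNIV. \<Sum>j\<in>UNIV. a i j * b i * d j)
        + (\<Sum>i\<in>UNIV. \<Sum>j\<in>UNIV. a i j * (d i * d j))"
    unfolding b'_eq sum.distrib[symmetric] sum_subtractf[symmetric]
    by (intro sum.cong refl) (simp add: algebra_simps)
  \<comment> \<open>Symmetry of \<open>a\<close> identifies the two mixed sums; the resulting factor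
    2 cancels the division by 2 in \<open>potential\<close>.\<close>
  also have "(\<Sum>i\<in>UNIV. \<Sum>j\<in>UNIV. a i j * b i * d j) = (\<Sum>i\<in>UNIV. \<Sum>j\<in>UNIV. a i j * b j * d i)"
    by (subst sum.swap) (simp add: sym)
  also have "(\<Sum>i\<in>UNIV. \<Sum>j\<in>UNIV. a i j * b j * d i) = (\<Sum>i\<in>UNIV. deg a i * mu a b i * d i)"
    by (simp add: deg_mu sum_distrib_right)
  finally have "(\<Sum>i\<in>UNIV. \<Sum>j\<in>UNIV. a i j * b' i * b' j) - (\<Sum>i\<in>UNIV. \<Sum>j\<in>UNIV. a i j * b i * b j)
      = 2 * (\<Sum>i\<in>UNIV. deg a i * mu a b i * d i) + (\<Sum>i\<in>UNIV. \<Sum>j\<in>UNIV. a i j * (d i * d j))"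
    by simp
  then have quad: "(\<Sum>i\<in>UNIV. \<Sum>j\<in>UNIV. a i j * b' i * b' j) - (\<Sum>i\<in>UNIV. \<Sum>j\<in>UNIV. a i j * b i * b j)
      \<ge> 2 * (\<Sum>i\<in>UNIV. deg a i * mu a b i * d i) - (\<Sum>i\<in>UNIV. \<Sum>j\<in>UNIV. a i j) * h\<^sup>2"
    using cross by linarith
  have "(\<Sum>i\<in>UNIV. deg a i * fbias_inverse_antideriv (\<gamma> i) (b' i))
      - (\<Sum>i\<in>UNIV. deg a i * fbias_inverse_antideriv (\<gamma> i) (b i))
    = (\<Sum>i\<in>UNIV. deg a i * (fbias_inverse_antideriv (\<gamma> i) (b' i) - fbias_inverse_antideriv (\<gamma> i) (b i)))"
    by (simp add: sum_subtractf algebra_simps)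
  also have "\<dots> \<le> (\<Sum>i\<in>UNIV. deg a i * (fbias (b i) (1 / \<gamma> i) * d i + L i * h\<^sup>2))"
  proof (intro sum_mono mult_left_mono)
    fix i
    have "fbias_inverse_antideriv (\<gamma> i) (b' i) - fbias_inverse_antideriv (\<gamma> i) (b i)
      \<le> fbias (b i) (1 / \<gamma> i) * d i + L i * (d i)\<^sup>2"
      unfolding d_def L_def using b b' gpos
      by (intro fbias_inverse_antideriv_upper) (auto simp: in_cube_def)
    also have "L i * (d i)\<^sup>2 \<le> L i * h\<^sup>2" by (intro mult_left_mono d2 L)
    finally show "fbias_inverse_antideriv (\<gamma> i) (b' i) - fbias_inverse_antideriv (\<gamma> i) (b i)
      \<le> fbias (b i) (1 / \<gamma> i) * d i + L i * h\<^sup>2" by simp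
  qed (simp add: deg_pos less_imp_le)
  also have "\<dots> = (\<Sum>i\<in>UNIV. deg a i * fbias (b i) (1 / \<gamma> i) * d i) + (\<Sum>i\<in>UNIV. deg a i * L i) * h\<^sup>2"
    by (simp add: algebra_simps sum.distrib sum_distrib_left)
  finally have conv: "(\<Sum>i\<in>UNIV. deg a i * fbias_inverse_antideriv (\<gamma> i) (b' i))
      - (\<Sum>i\<in>UNIV. deg a i * fbias_inverse_antideriv (\<gamma> i) (b i))
    \<le> (\<Sum>i\<in>UNIV. deg a i * fbias (b i) (1 / \<gamma> i) * d i) + (\<Sum>i\<in>UNIV. deg a i * L i) * h\<^sup>2" .
  have grad: "(\<Sum>i\<in>UNIV. gradient b i * (b' i - b i))
    = (\<Sum>i\<in>UNIV. deg a i * mu a b i * d i) - (\<Sum>i\<in>UNIV. deg a i * fbias (b i) (1 / \<gamma> i) * d i)"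
    by (simp add: gradient_def d_def sum_subtractf[symmetric] algebra_simps)
  have curv: "curvature * h\<^sup>2 = (\<Sum>i\<in>UNIV. \<Sum>j\<in>UNIV. a i j) * h\<^sup>2 / 2 + (\<Sum>i\<in>UNIV. deg a i * L i) * h\<^sup>2"
    by (simp add: curvature_def L_def algebra_simps)
  show ?thesis using quad conv unfolding potential_def grad curv by (simp add: diff_divide_distrib)
qed

lemma potential_bounded: "\<exists>B. \<forall>b. in_cube b \<longrightarrow> \<bar>potential b\<bar> \<le> B"
proof -
  let ?A = "\<Sum>i\<in>UNIV. \<Sum>j\<in>UNIV. a i j"
  let ?D = "\<Sum>i\<in>UNIV. deg a i * (1 + \<bar>fbias_inverse_antideriv (\<gamma> i) 0\<bar>)"
  have "\<bar>potential b\<bar> \<le> ?A / 2 + ?D" if b: "in_cube b" for b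
  proof -
    have "\<bar>\<Sum>i\<in>UNIV. \<Sum>j\<in>UNIV. a i j * b i * b j\<bar> \<le> ?A"
    proof -
      have "\<bar>a i j * b i * b j\<bar> \<le> a i j" for i j
      proof -
        have "b i * b j \<le> 1" using b by (intro mult_le_one) (auto simp: in_cube_def)
        then have "a i j * (b i * b j) \<le> a i j" using nonneg[of i j] by (simp add: mult_left_le)
        then show ?thesis using b nonneg[of i j] by (simp add: in_cube_def abs_mult mult.assoc)
      qed
      then show ?thesis by (intro order_trans[OF sum_abs] sum_mono)
    qed
    moreover have "\<bar>\<Sum>i\<in>UNIV. deg a i * fbias_inverse_antideriv (\<gamma> i) (b i)\<bar> \<le> ?D"
    proof (intro order_trans[OF sum_abs] sum_mono)
      fix i
      have "\<bar>fbias_inverse_antideriv (\<gamma> i) (b i)\<bar> \<le> 1 + \<bar>fbias_inverse_antideriv (\<gamma> i) 0\<bar>"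
        using fbias_inverse_antideriv_bounded[OF gpos, of "b i" i] b by (simp add: in_cube_def)
      then show "\<bar>deg a i * fbias_inverse_antideriv (\<gamma> i) (b i)\<bar>
          \<le> deg a i * (1 + \<bar>fbias_inverse_antideriv (\<gamma> i) 0\<bar>)"
        using deg_pos[of i] by (simp add: abs_mult)
    qed
    ultimately show ?thesis unfolding potential_def by linarith
  qed
  then show ?thesis by blast
qed

lemma gradient_bounded:
  assumes "in_cube b" shows "\<bar>gradient b i\<bar> \<le> deg a i"
proof -
  have "0 \<le> fbias (b i) (1 / \<gamma> i)" "fbias (b i) (1 / \<gamma> i) \<le> 1"
    using assms gpos[of i] by (auto simp: in_cube_def intro!: fbias_range)
  then have "\<bar>mu a b i - fbias (b i) (1 / \<gamma> i)\<bar> \<le> 1"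
    using mu_nonneg[OF assms, of i] mu_le_1[OF assms, of i] by linarith
  then show ?thesis using deg_pos[of i] by (simp add: gradient_def abs_mult mult_left_le)
qed

section \<open>Fixed points\<close>

text \<open>Opinion 0 at a fixed point forces the neighbourhood average to be 0. A vanishing sum of
  nonnegative terms makes every neighbour 0, and connectedness spreads this.\<close>

lemma fixed_point_zero:
  assumes b: "in_cube b" and fp: "Fmap a \<gamma> b = b" and "b i = 0"
  shows "b j = 0"
proof (rule propagate[of "\<lambda>j. b j = 0" i])
  fix x y assume x: "b x = 0" and xy: "a x y > 0"
  have "fbias (mu a b x) (\<gamma> x) = 0" using fp x by (metis Fmap_def)
  then have "mu a b x = 0"
    using fbias_denom_pos[OF gpos mu_nonneg[OF b] mu_le_1[OF b]] gpos[of x]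
    by (auto simp: fbias_def) (metis less_irrefl)
  then have "(\<Sum>j\<in>UNIV. a x j * b j) = 0" using deg_mu[of x b] by simp
  then have "a x y * b y = 0"
    using b nonneg by (subst (asm) sum_nonneg_eq_0_iff) (auto simp: in_cube_def)
  then show "b y = 0" using xy by simp
qed fact

text \<open>The mirror image of the previous argument, applied to the complements
  \<open>1 - b j\<close>.\<close>

lemma fixed_point_one:
  assumes b: "in_cube b" and fp: "Fmap a \<gamma> b = b" and "b i = 1"
  shows "b j = 1"
proof (rule propagate[of "\<lambda>j. b j = 1" i])
  fix x y assume x: "b x = 1" and xy: "a x y > 0"
  have "1 - fbias (mu a b x) (\<gamma> x) = 0" using fp x by (metis Fmap_def diff_self)
  then have "1 - mu a b x = 0"
    using fbias_denom_pos[OF gpos mu_nonneg[OF b] mu_le_1[OF b], of x x]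
    unfolding one_minus_fbias[OF gpos mu_nonneg[OF b] mu_le_1[OF b]] by auto
  then have "(\<Sum>j\<in>UNIV. a x j * (1 - b j)) = 0" using deg_mu_complement[of x b] by simp
  then have "a x y * (1 - b y) = 0"
    using b nonneg by (subst (asm) sum_nonneg_eq_0_iff) (auto simp: in_cube_def)
  then show "b y = 1" using xy by simp
qed fact

lemma fixed_point_cases:
  assumes "in_cube b" "Fmap a \<gamma> b = b"
  shows "b = (\<lambda>_. 0) \<or> b = (\<lambda>_. 1) \<or> (\<forall>i. 0 < b i \<and> b i < 1)"
proof (cases "\<forall>i. 0 < b i \<and> b i < 1")
  case False
  then obtain i where "b i = 0 \<or> b i = 1" using assms(1) by (auto simp: in_cube_def order_less_le)
  then show ?thesis
  proof
    assume "b i = 0"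
    then have "b = (\<lambda>_. 0)" by (intro ext) (rule fixed_point_zero[OF assms])
    then show ?thesis by blast
  next
    assume "b i = 1"
    then have "b = (\<lambda>_. 1)" by (intro ext) (rule fixed_point_one[OF assms])
    then show ?thesis by blast
  qed
qed blast

section \<open>Comparison of two fixed points\<close>

lemma fixed_point_mu:
  assumes b: "in_cube b" and fp: "Fmap a \<gamma> b = b"
  shows "mu a b i * (\<gamma> i + (1 - \<gamma> i) * b i) = b i"
    "(1 - mu a b i) * (\<gamma> i + (1 - \<gamma> i) * b i) = \<gamma> i * (1 - b i)"
proof -
  have "\<gamma> i * mu a b i = b i * (1 + (\<gamma> i - 1) * mu a b i)"
    using fbias_denom_pos[OF gpos mu_nonneg[OF b] mu_le_1[OF b], of i i] fun_cong[OF fp, of i]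
    by (simp add: Fmap_def fbias_def field_simps)
  then show "mu a b i * (\<gamma> i + (1 - \<gamma> i) * b i) = b i" by (simp add: algebra_simps)
  then show "(1 - mu a b i) * (\<gamma> i + (1 - \<gamma> i) * b i) = \<gamma> i * (1 - b i)"
    by (simp add: algebra_simps)
qed

text \<open>Over the same product of denominators, the left side is
  \<open>\<gamma> i * (q i - p i)\<close> and \<open>mu a q i * (1 - mu a p i)\<close> is
  \<open>\<gamma> i * q i * (1 - p i)\<close>. Their quotient eliminates the bias parameter.\<close>

lemma mu_diff_fixed_points:
  assumes p: "in_cube p" "Fmap a \<gamma> p = p" and q: "in_cube q" "Fmap a \<gamma> q = q"
    and pi: "p i < 1" and qi: "0 < q i"
  shows "mu a q i - mu a p i
    = (q i - p i) / (q i * (1 - p i)) * (mu a q i * (1 - mu a p i))"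
proof -
  let ?u = "\<gamma> i + (1 - \<gamma> i) * q i" and ?v = "\<gamma> i + (1 - \<gamma> i) * p i"
  have u: "?u > 0" and v: "?v > 0"
    using p(1) q(1) by (auto simp: in_cube_def intro!: fbias_denom_inverse_pos gpos)
  have mq: "mu a q i = q i / ?u" using fixed_point_mu(1)[OF q, of i] u by (simp add: eq_divide_eq)
  have mp: "mu a p i = p i / ?v" using fixed_point_mu(1)[OF p, of i] v by (simp add: eq_divide_eq)
  have mp': "1 - mu a p i = \<gamma> i * (1 - p i) / ?v"
    using fixed_point_mu(2)[OF p, of i] v by (simp add: eq_divide_eq)
  have "mu a q i - mu a p i = (q i * ?v - p i * ?u) / (?u * ?v)"
    unfolding mq mp using u v by (simp add: diff_frac_eq)
  also have "q i * ?v - p i * ?u = \<gamma> i * (q i - p i)" by (simp add: algebra_simps)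
  also have "\<gamma> i * (q i - p i) / (?u * ?v)
      = (q i - p i) / (q i * (1 - p i)) * (q i / ?u * (\<gamma> i * (1 - p i) / ?v))"
  proof -
    have "g * d / (u * v) = d / (s * r) * (s / u * (g * r / v))"
      if "s \<noteq> 0" "r \<noteq> 0" for g d u v s r :: real
      using that by simp
    then show ?thesis using pi qi by simp
  qed
  finally show ?thesis unfolding mp' mq .
qed

text \<open>Neighbourhood covariance of two profiles, unnormalised.\<close>

definition ncov :: "('n \<Rightarrow> real) \<Rightarrow> ('n \<Rightarrow> real) \<Rightarrow> 'n \<Rightarrow> real" where
  "ncov p q i = (\<Sum>j\<in>UNIV. a i j * (p j - mu a p i) * q j)"

lemma ncov_eq: "ncov p q i = (\<Sum>j\<in>UNIV. a i j * (p j * q j)) - deg a i * mu a p i * mu a q i"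
proof -
  have "ncov p q i = (\<Sum>j\<in>UNIV. a i j * (p j * q j)) - mu a p i * (\<Sum>j\<in>UNIV. a i j * q j)"
    unfolding ncov_def sum_distrib_left sum_subtractf[symmetric]
    by (intro sum.cong refl) (simp add: algebra_simps)
  then show ?thesis unfolding deg_mu[symmetric] by simp
qed

text \<open>The weighted deviations from the average sum to 0, so the second factor may be centred
  too, which yields a weighted variance.\<close>

lemma ncov_self: "ncov p p i = (\<Sum>j\<in>UNIV. a i j * (p j - mu a p i)\<^sup>2)"
proof -
  have "(\<Sum>j\<in>UNIV. a i j * (p j - mu a p i)) = 0"
    using deg_mu[of i p] by (simp add: right_diff_distrib sum_subtractf sum_distrib_right[symmetric] deg_def)
  then have "ncov p p i = ncov p p i - mu a p i * (\<Sum>j\<in>UNIV. a i j * (p j - mu a p i))" by simp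
  also have "\<dots> = (\<Sum>j\<in>UNIV. a i j * (p j - mu a p i)\<^sup>2)"
    unfolding ncov_def sum_distrib_left sum_subtractf[symmetric]
    by (intro sum.cong refl) (simp add: power2_eq_square algebra_simps)
  finally show ?thesis .
qed

lemma ncov_self_nonneg: "0 \<le> ncov p p i"
  unfolding ncov_self by (intro sum_nonneg mult_nonneg_nonneg nonneg) auto

text \<open>The product is the common factor of the terms of \<open>ncov p q i\<close> for every
  \<open>q\<close>: zero variance of \<open>p\<close> makes all these covariances vanish.\<close>

lemma ncov_self_zeroD:
  assumes "ncov p p i = 0" shows "a i j * (p j - mu a p i) = 0"
proof -
  have "a i j * (p j - mu a p i)\<^sup>2 = 0"
    using assms nonneg unfolding ncov_self by (subst (asm) sum_nonneg_eq_0_iff) auto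
  then show ?thesis by auto
qed

text \<open>If every neighbourhood is constant then each edge exchanges the pair (opinion,
  neighbourhood average), so two distinct values would 2-colour the graph.\<close>

lemma interior_fixed_point_ncov_pos:
  assumes int: "\<And>i. 0 < p i \<and> p i < 1" and fp: "Fmap a \<gamma> p = p"
  shows "\<exists>i. ncov p p i > 0"
proof (rule ccontr)
  assume "\<nexists>i. ncov p p i > 0"
  then have "ncov p p i = 0" for i using ncov_self_nonneg[of p i] by (metis order_le_less)
  then have nb: "p j = mu a p i" if "a i j > 0" for i j
    using ncov_self_zeroD[of p i j] that by simp
  fix i0
  define u where "u = p i0"
  define v where "v = mu a p i0"
  have uv: "(p j = u \<and> mu a p j = v) \<or> (p j = v \<and> mu a p j = u)" for j
  proof (rule propagate[where i = i0])
    fix x y assume "(p x = u \<and> mu a p x = v) \<or> (p x = v \<and> mu a p x = u)" "a x y > 0"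
    then show "(p y = u \<and> mu a p y = v) \<or> (p y = v \<and> mu a p y = u)"
      using nb[of x y] nb[of y x] sym[of x y] by auto
  qed (simp add: u_def v_def)
  have "u = v"
  proof (rule ccontr)
    assume "u \<noteq> v"
    then have "(p x = u) \<noteq> (p y = u)" if "a x y > 0" for x y
      using nb[OF that] uv[of x] uv[of y] by auto
    then have "graph_bipartite a" unfolding graph_bipartite_def by (intro exI[of _ "\<lambda>x. p x = u"]) auto
    then show False using nonbip by simp
  qed
  \<comment> \<open>With \<open>u = v\<close> each agent's average equals its own interior opinion,
    and only the unbiased map fixes such a value.\<close>
  have "\<gamma> i = 1" for i
  proof (rule fbias_eq_self_imp_unbiased)
    show "fbias (p i) (\<gamma> i) = p i"
      using fun_cong[OF fp, of i] uv[of i] \<open>u = v\<close> by (auto simp: Fmap_def)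
  qed (use int gpos in auto)
  then show False using gnot1 by simp
qed

text \<open>A maximum principle: where y attains a positive maximum, both sides of the equation vanish,
  so the maximum is also attained at all neighbours.\<close>

lemma weighted_laplacian_nonpos:
  assumes w: "\<And>i. w i > 0" and C: "\<And>i. C i \<ge> 0" and Ci: "C i0 > 0"
    and eq: "\<And>i. (\<Sum>j\<in>UNIV. a i j * w j * (y j - y i)) = y i * C i"
  shows "y i \<le> (0::real)"
proof (rule ccontr)
  assume "\<not> y i \<le> 0"
  define M where "M = Max (range y)"
  have le: "y j \<le> M" for j by (simp add: M_def)
  have M: "M > 0" using le[of i] \<open>\<not> y i \<le> 0\<close> by simp
  have "M \<in> range y" unfolding M_def by (rule Max_in) auto
  then obtain k where k: "y k = M" by auto
  have key: "C x = 0 \<and> (\<forall>z. a x z > 0 \<longrightarrow> y z = M)" if x: "y x = M" for x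
  proof -
    have np: "a x j * w j * (y j - y x) \<le> 0" for j
      using le[of j] w[of j] nonneg[of x j] x by (simp add: mult_nonneg_nonpos)
    have "0 \<le> M * C x" using M C[of x] by simp
    then have 0: "(\<Sum>j\<in>UNIV. a x j * w j * (y j - y x)) = 0"
      using eq[of x] x sum_nonpos[of UNIV "\<lambda>j. a x j * w j * (y j - y x)"] np by simp
    have "a x z * w z * (y z - y x) = 0" for z
    proof -
      have "(\<Sum>j\<in>UNIV. - (a x j * w j * (y j - y x))) = 0" using 0 by (simp only: sum_negf minus_zero)
      then have "- (a x z * w z * (y z - y x)) = 0"
        using np by (subst (asm) sum_nonneg_eq_0_iff) auto
      then show ?thesis by simp
    qed
    moreover have "C x = 0" using 0 eq[of x] x M by simp
    ultimately show ?thesis using w x by (auto simp: order_less_le)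
  qed
  \<comment> \<open>The maximum spreads to \<open>i0\<close>, where \<open>C\<close> would then have
    to vanish.\<close>
  have "y i0 = M" by (rule propagate[of "\<lambda>j. y j = M", OF k]) (use key in blast)
  then have "C i0 = 0" by (rule key[THEN conjunct1])
  then show False using Ci by simp
qed

text \<open>In the equation for \<open>y\<close>, \<open>mu_diff_fixed_points\<close> contributes
  \<open>deg a i * mu a q i * (1 - mu a p i)\<close> and the weights subtract
  \<open>deg a i * mu a q i\<close> minus the sum of the products; what remains is the covariance.
  The equation is linear, so the maximum principle applies to \<open>y\<close> and to
  \<open>- y\<close>.\<close>

lemma interior_fixed_point_unique_if_ncov_nonneg:
  assumes p: "\<And>i. 0 < p i \<and> p i < 1" "Fmap a \<gamma> p = p"
    and q: "in_cube q" "\<And>i. 0 < q i" "Fmap a \<gamma> q = q"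
    and cov: "\<And>i. 0 \<le> ncov p q i" "ncov p q i0 > 0"
  shows "q = p"
proof
  have pc: "in_cube p" using p(1) by (auto simp: in_cube_def less_imp_le)
  define w where "w i = q i * (1 - p i)" for i
  define y where "y i = (q i - p i) / w i" for i
  have w: "w i > 0" for i using p(1)[of i] q(2)[of i] by (simp add: w_def)
  have eq: "(\<Sum>j\<in>UNIV. a i j * w j * (y j - y i)) = y i * ncov p q i" for i
  proof -
    have "(\<Sum>j\<in>UNIV. a i j * w j * (y j - y i))
        = (\<Sum>j\<in>UNIV. a i j * (q j - p j)) - y i * (\<Sum>j\<in>UNIV. a i j * w j)"
      unfolding sum_distrib_left sum_subtractf[symmetric]
    proof (intro sum.cong refl)
      fix j
      have "w j * y j = q j - p j" using w[of j] by (simp add: y_def)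
      then show "a i j * w j * (y j - y i) = a i j * (q j - p j) - y i * (a i j * w j)"
        by (simp flip: \<open>w j * y j = q j - p j\<close> add: algebra_simps)
    qed
    also have "(\<Sum>j\<in>UNIV. a i j * (q j - p j)) = deg a i * (mu a q i - mu a p i)"
      by (simp add: right_diff_distrib sum_subtractf deg_mu)
    also have "\<dots> = y i * (deg a i * mu a q i - deg a i * mu a p i * mu a q i)"
    proof -
      have "mu a q i - mu a p i = y i * (mu a q i * (1 - mu a p i))"
        unfolding y_def w_def
        by (rule mu_diff_fixed_points[OF pc p(2) q(1,3) p(1)[THEN conjunct2] q(2)])
      then show ?thesis by (simp only:) (simp add: algebra_simps)
    qed
    also have "(\<Sum>j\<in>UNIV. a i j * w j) = deg a i * mu a q i - (\<Sum>j\<in>UNIV. a i j * (p j * q j))"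
      unfolding deg_mu sum_subtractf[symmetric] w_def by (intro sum.cong refl) (simp add: algebra_simps)
    finally show ?thesis unfolding ncov_eq by (simp add: algebra_simps)
  qed
  fix i
  have "y i \<le> 0" using weighted_laplacian_nonpos[of w "ncov p q" i0 y] w cov eq by blast
  moreover have "- y i \<le> 0"
  proof (rule weighted_laplacian_nonpos[of w "ncov p q" i0 "\<lambda>i. - y i"])
    show "(\<Sum>j\<in>UNIV. a i j * w j * (- y j - - y i)) = - y i * ncov p q i" for i
    proof -
      have "(\<Sum>j\<in>UNIV. a i j * w j * (- y j - - y i)) = - (\<Sum>j\<in>UNIV. a i j * w j * (y j - y i))"
        unfolding sum_negf[symmetric] by (intro sum.cong refl) (simp add: algebra_simps)
      then show ?thesis unfolding eq by simp
    qed
  qed (use w cov in auto)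
  ultimately have "y i = 0" by simp
  then show "q i = p i" using w[of i] by (simp add: y_def)
qed

text \<open>Covariances are continuous in \<open>q\<close>. A positive variance of \<open>p\<close>
  therefore stays a positive covariance nearby, while a zero variance makes the covariance
  identically 0 in \<open>q\<close>; so all sign conditions of the uniqueness lemma hold near
  \<open>p\<close>.\<close>

lemma interior_fixed_point_isolated:
  fixes p :: "real ^ 'n"
  assumes p: "\<And>i. 0 < p $ i \<and> p $ i < 1" "Fmap a \<gamma> (($) p) = ($) p"
  shows "eventually (\<lambda>q. in_cube (($) q) \<and> Fmap a \<gamma> (($) q) = ($) q \<longrightarrow> q = p) (nhds p)"
proof -
  have coord: "((\<lambda>q. q $ i) \<longlongrightarrow> p $ i) (nhds p)" for i
    by (rule tendsto_vec_nth[OF filterlim_ident])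
  have "eventually (\<lambda>q. 0 < q $ i) (nhds p)" for i
    using order_tendstoD(1)[OF coord] p(1) by blast
  then have ev1: "eventually (\<lambda>q. \<forall>i. 0 < q $ i) (nhds p)" by (rule eventually_all_finite)
  have lim: "((\<lambda>q. ncov (($) p) (($) q) i) \<longlongrightarrow> ncov (($) p) (($) p) i) (nhds p)" for i
    unfolding ncov_def by (intro tendsto_intros coord)
  have pos: "eventually (\<lambda>q. 0 < ncov (($) p) (($) q) i) (nhds p)" if "ncov (($) p) (($) p) i > 0" for i
    using order_tendstoD(1)[OF lim that] .
  have "eventually (\<lambda>q. 0 \<le> ncov (($) p) (($) q) i) (nhds p)" for i
  proof (cases "ncov (($) p) (($) p) i = 0")
    case True
    then have "ncov (($) p) (($) q) i = 0" for q :: "real ^ 'n"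
      using ncov_self_zeroD[OF True] unfolding ncov_def by (intro sum.neutral) auto
    then show ?thesis by simp
  next
    case False
    then have "ncov (($) p) (($) p) i > 0" using ncov_self_nonneg[of "($) p" i] by simp
    then show ?thesis by (intro eventually_mono[OF pos]) auto
  qed
  then have ev2: "eventually (\<lambda>q. \<forall>i. 0 \<le> ncov (($) p) (($) q) i) (nhds p)" by (rule eventually_all_finite)
  obtain i0 where "ncov (($) p) (($) p) i0 > 0"
    using interior_fixed_point_ncov_pos[of "($) p"] p by auto
  then have "eventually (\<lambda>q. 0 < ncov (($) p) (($) q) i0) (nhds p)" by (rule pos)
  with ev1 ev2 show ?thesis
  proof eventually_elim
    case (elim q)
    show ?case
    proof
      assume "in_cube (($) q) \<and> Fmap a \<gamma> (($) q) = ($) q"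
      then have "($) q = ($) p"
        using interior_fixed_point_unique_if_ncov_nonneg[of "($) p" "($) q" i0] p elim by auto
      then show "q = p" by (simp add: vec_eq_iff)
    qed
  qed
qed

text \<open>Only the consensus points 0 and 1 may be limits of other fixed points, but each of them
  is isolated in a set of fixed points without interior members.\<close>

lemma slowly_varying_converges_if_cluster_points_fixed:
  fixes x :: "nat \<Rightarrow> real ^ 'n"
  assumes cube: "\<And>n. in_cube (($) (x n))"
    and step: "(\<lambda>n. dist (x (Suc n)) (x n)) \<longlonglongrightarrow> 0"
    and fixed: "\<And>s q. strict_mono s \<Longrightarrow> (x \<circ> s) \<longlonglongrightarrow> q \<Longrightarrow> in_cube (($) q) \<and> Fmap a \<gamma> (($) q) = ($) q"
  shows "\<exists>p. x \<longlonglongrightarrow> p"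
proof -
  have "x n \<in> cbox 0 1" for n
    using cube[of n] by (simp add: in_cube_def mem_box_cart one_vec_def zero_vec_def)
  then have bdd: "bounded (range x)"
    by (intro bounded_subset[OF bounded_cbox[of 0 1]]) auto
  define L where "L = {q. \<exists>s. strict_mono s \<and> (x \<circ> s) \<longlonglongrightarrow> q}"
  have conv: "\<exists>p. x \<longlonglongrightarrow> p" if p: "p \<in> L" "eventually (\<lambda>q. q \<in> L \<longrightarrow> q = p) (nhds p)" for p
  proof -
    obtain s where s: "strict_mono s" "(x \<circ> s) \<longlonglongrightarrow> p" using p(1) unfolding L_def by blast
    obtain e where e: "e > 0" "\<And>q. dist q p < e \<Longrightarrow> q \<in> L \<Longrightarrow> q = p"
      using p(2) unfolding eventually_nhds_metric by blast
    have "x \<longlonglongrightarrow> p"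
    proof (rule slowly_varying_converges_to_isolated_cluster_point[OF bdd step s e(1)])
      fix s' q assume "strict_mono s'" "(x \<circ> s') \<longlonglongrightarrow> q" "dist q p < e"
      then show "q = p" using e(2) by (auto simp: L_def)
    qed
    then show ?thesis by blast
  qed
  have fixedL: "in_cube (($) q) \<and> Fmap a \<gamma> (($) q) = ($) q" if "q \<in> L" for q
    using that fixed by (auto simp: L_def)
  obtain s p where "strict_mono (s :: nat \<Rightarrow> nat)" "(x \<circ> s) \<longlonglongrightarrow> p"
    using bounded_imp_convergent_subsequence[OF bdd] by metis
  then have pL: "p \<in> L" by (auto simp: L_def)
  show ?thesis
  proof (cases "\<exists>q\<in>L. \<forall>i. 0 < q $ i \<and> q $ i < 1")
    case True
    then obtain q where q: "q \<in> L" "\<And>i. 0 < q $ i \<and> q $ i < 1" by blast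
    have "eventually (\<lambda>q'. in_cube (($) q') \<and> Fmap a \<gamma> (($) q') = ($) q' \<longrightarrow> q' = q) (nhds q)"
      using interior_fixed_point_isolated q fixedL by blast
    then have "eventually (\<lambda>q'. q' \<in> L \<longrightarrow> q' = q) (nhds q)"
      by eventually_elim (use fixedL in blast)
    then show ?thesis by (rule conv[OF q(1)])
  next
    case False
    have consensus: "q = 0 \<or> q = 1" if "q \<in> L" for q
    proof -
      have "($) q = (\<lambda>_. 0) \<or> ($) q = (\<lambda>_. 1)"
        using fixed_point_cases[of "($) q"] fixedL[OF that] False that by blast
      then show ?thesis by (metis vec_eq_iff zero_index one_index)
    qed
    have "eventually (\<lambda>q. q \<in> L \<longrightarrow> q = p) (nhds p)"
    proof -
      \<comment> \<open>The distance between the two consensus points serves as radius: the open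
        ball around either one excludes the other.\<close>
      have "dist (0 :: real ^ 'n) 1 > 0" by simp
      moreover have "q = p" if "dist q p < dist (0 :: real ^ 'n) 1" "q \<in> L" for q
        using consensus[OF that(2)] consensus[OF pL] that(1) by (auto simp: dist_commute)
      ultimately show ?thesis unfolding eventually_nhds_metric by blast
    qed
    then show ?thesis by (rule conv[OF pL])
  qed
qed

section \<open>Convergence of a single path\<close>

lemma continuous_on_ascent:
  "continuous_on {q :: real ^ 'n. in_cube (($) q)} (\<lambda>q. ascent (($) q))"
proof -
  have mu: "continuous_on S (\<lambda>q :: real ^ 'n. mu a (($) q) i)" for S i
    unfolding mu_def using deg_pos[of i] by (intro continuous_intros) auto
  have "continuous_on {q :: real ^ 'n. in_cube (($) q)} (\<lambda>q. fbias (mu a (($) q) i) (\<gamma> i))" for i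
    unfolding fbias_def using fbias_denom_pos[OF gpos mu_nonneg mu_le_1]
    by (intro continuous_intros mu) (auto simp: less_imp_neq[symmetric])
  moreover have "continuous_on {q :: real ^ 'n. in_cube (($) q)} (\<lambda>q. fbias (q $ i) (1 / \<gamma> i))" for i
    unfolding fbias_inverse[OF gpos]
    by (intro continuous_intros)
      (auto simp: in_cube_def less_imp_neq[symmetric] fbias_denom_inverse_pos gpos)
  ultimately show ?thesis
    unfolding ascent_def gradient_def Fmap_def by (intro continuous_intros mu)
qed

text \<open>Summability makes \<open>ascent\<close> vanish at every cluster point, so all cluster
  points are fixed points and the isolation argument applies. The path is recast in
  \<open>real ^ 'n\<close> to use its metric.\<close>

lemma converges_to_fixed_point:
  fixes \<beta> :: "nat \<Rightarrow> 'n \<Rightarrow> real"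
  assumes cube: "\<And>t. in_cube (\<beta> t)"
    and step: "\<And>t i. \<bar>\<beta> (Suc t) i - \<beta> t i\<bar> \<le> 1 / real (Suc t)"
    and summ: "summable (\<lambda>t. ascent (\<beta> t) / real (Suc t))"
  shows "\<exists>b. in_cube b \<and> Fmap a \<gamma> b = b \<and> (\<forall>i. (\<lambda>t. \<beta> t i) \<longlonglongrightarrow> b i)"
proof -
  define x :: "nat \<Rightarrow> real ^ 'n" where "x t = (\<chi> i. \<beta> t i)" for t
  have x: "($) (x t) = \<beta> t" for t by (auto simp: x_def fun_eq_iff)
  let ?S = "{q :: real ^ 'n. in_cube (($) q)}"
  have dist: "dist (x (Suc t)) (x t) \<le> real CARD('n) / real (Suc t)" for t
  proof -
    \<comment> \<open>The Euclidean norm is at most the sum of the absolute coordinates, whence the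
      factor \<open>CARD('n)\<close>.\<close>
    have "dist (x (Suc t)) (x t) \<le> (\<Sum>i\<in>UNIV. \<bar>(x (Suc t) - x t) $ i\<bar>)"
      unfolding dist_norm by (rule norm_le_l1_cart)
    also have "\<dots> \<le> (\<Sum>i\<in>(UNIV :: 'n set). 1 / real (Suc t))"
      by (intro sum_mono) (simp add: x_def step del: of_nat_Suc)
    finally show ?thesis by simp
  qed
  have step0: "(\<lambda>t. dist (x (Suc t)) (x t)) \<longlonglongrightarrow> 0"
  proof (rule tendsto_sandwich[OF _ _ tendsto_const])
    show "(\<lambda>t. real CARD('n) / real (Suc t)) \<longlonglongrightarrow> 0"
      by (intro LIMSEQ_Suc[OF lim_const_over_n])
  qed (use dist in auto)
  have fixed: "in_cube (($) q) \<and> Fmap a \<gamma> (($) q) = ($) q"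
    if s: "strict_mono s" "(x \<circ> s) \<longlonglongrightarrow> q" for s q
  proof -
    have lim: "(\<lambda>k. \<beta> (s k) i) \<longlonglongrightarrow> q $ i" for i
      using tendsto_vec_nth[OF s(2), of i] by (simp add: x_def)
    have q: "in_cube (($) q)"
      using cube unfolding in_cube_def
      by (auto intro: LIMSEQ_le_const[OF lim] LIMSEQ_le_const2[OF lim])
    have "ascent (($) q) = 0"
      by (rule weighted_summable_imp_zero_at_cluster_point[OF dist continuous_on_ascent _ _ _ _ s])
        (use cube q summ ascent_nonneg x in auto)
    then show ?thesis using q ascent_eq_0D by blast
  qed
  have "\<exists>p. x \<longlonglongrightarrow> p"
    by (rule slowly_varying_converges_if_cluster_points_fixed[OF _ step0 fixed]) (simp_all add: cube x)
  then obtain p where p: "x \<longlonglongrightarrow> p" by blast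
  have "(x \<circ> id) \<longlonglongrightarrow> p" using p by simp
  then have "in_cube (($) p) \<and> Fmap a \<gamma> (($) p) = ($) p" by (rule fixed[OF strict_mono_id])
  moreover have "(\<lambda>t. \<beta> t i) \<longlonglongrightarrow> p $ i" for i
    using tendsto_vec_nth[OF p, of i] by (simp add: x_def)
  ultimately show ?thesis by blast
qed

end

section \<open>The stochastic process\<close>

text \<open>The index set is a product set with coordinate \<open>i\<close> restricted to
  \<open>True\<close>, so the sum factorises and every other coordinate contributes
  \<open>p j + (1 - p j) = 1\<close>.\<close>

lemma sum_prod_bernoulli_marginal:
  fixes p :: "'n::finite \<Rightarrow> real"
  shows "(\<Sum>v | v i. \<Prod>j\<in>UNIV. if v j then p j else 1 - p j) = p i"
proof -
  define B where "B j = (if j = i then {True} else UNIV)" for j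
  have "{v. v i} = PiE UNIV B" by (auto simp: B_def PiE_def Pi_def)
  then have "(\<Sum>v | v i. \<Prod>j\<in>UNIV. if v j then p j else 1 - p j)
      = (\<Prod>j\<in>UNIV. \<Sum>y\<in>B j. if y then p j else 1 - p j)"
    by (simp only:) (rule prod_sum_PiE[symmetric], auto simp: B_def)
  also have "\<dots> = (\<Prod>j\<in>UNIV. if j = i then p j else 1)"
    by (intro prod.cong refl) (simp add: B_def UNIV_bool)
  finally show ?thesis by simp
qed

locale opinion_process = bias_network a \<gamma> + prob_space M
  for a :: "'n::finite \<Rightarrow> 'n \<Rightarrow> real" and \<gamma> :: "'n \<Rightarrow> real" and M :: "'w measure" +
  fixes b1 :: "'n \<Rightarrow> real" and \<psi> :: "nat \<Rightarrow> 'n \<Rightarrow> 'w \<Rightarrow> bool"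
  assumes b1: "\<And>i. 0 < b1 i \<and> b1 i < 1"
    and meas: "\<And>t i. \<psi> t i \<in> measurable M (count_space UNIV)"
    and law: "\<And>t (v :: 'n \<Rightarrow> bool). t \<ge> 1 \<Longrightarrow>
       AE \<omega> in M. real_cond_exp M (history M \<psi> t)
           (indicator {\<omega>' \<in> space M. \<forall>i. \<psi> (Suc t) i \<omega>' = v i} :: 'w \<Rightarrow> real) \<omega>
         = (\<Prod>i\<in>UNIV. if v i then Fmap a \<gamma> (beta \<psi> b1 t \<omega>) i
                              else 1 - Fmap a \<gamma> (beta \<psi> b1 t \<omega>) i)"
begin

abbreviation opinion :: "nat \<Rightarrow> 'w \<Rightarrow> 'n \<Rightarrow> real" where
  "opinion \<equiv> beta \<psi> b1"

lemma opinion_Suc: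
  assumes "t \<ge> 1"
  shows "opinion (Suc t) \<omega> i - opinion t \<omega> i = (of_bool (\<psi> (Suc t) i \<omega>) - opinion t \<omega> i) / real (Suc t)"
proof -
  obtain k where "t = Suc k" using assms by (cases t) auto
  have "(n - 1) / n * x + 1 / n * c - x = (c - x) / n" if "n \<noteq> 0" for n x c :: real
    using that by (simp add: field_simps)
  from this[of "real (Suc t)"] show ?thesis using \<open>t = Suc k\<close> by (simp add: of_bool_def)
qed

lemma in_cube_opinion: "in_cube (opinion t \<omega>)"
proof (induction t)
  case 0
  then show ?case using b1 by (simp add: in_cube_def less_imp_le)
next
  case (Suc t)
  show ?case
  proof (cases t)
    case 0
    then show ?thesis using b1 by (simp add: in_cube_def less_imp_le)
  next
    case (Suc k)
    have "0 \<le> opinion (Suc t) \<omega> i \<and> opinion (Suc t) \<omega> i \<le> 1" for i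
    proof -
      have o: "0 \<le> opinion t \<omega> i" "opinion t \<omega> i \<le> 1" using Suc.IH by (auto simp: in_cube_def)
      have eq: "opinion (Suc t) \<omega> i
          = (real t * opinion t \<omega> i + of_bool (\<psi> (Suc t) i \<omega>)) / real (Suc t)"
        using opinion_Suc[of t \<omega> i] Suc by (simp add: field_simps del: beta.simps)
      have "real t * opinion t \<omega> i \<le> real t" using o by (simp add: mult_left_le)
      then show ?thesis unfolding eq using o by (simp add: divide_le_eq)
    qed
    then show ?thesis by (simp add: in_cube_def)
  qed
qed

text \<open>For \<open>t = 0\<close> the increment is 0, since times 0 and 1 both carry
  \<open>b1\<close>; thus the bound holds from index 0 on, as the pathwise argument expects.\<close>

lemma opinion_step: "\<bar>opinion (Suc t) \<omega> i - opinion t \<omega> i\<bar> \<le> 1 / real (Suc t)"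
proof (cases "t = 0")
  case False
  have "\<bar>of_bool (\<psi> (Suc t) i \<omega>) - opinion t \<omega> i\<bar> \<le> 1"
  proof -
    have "0 \<le> opinion t \<omega> i" "opinion t \<omega> i \<le> 1" using in_cube_opinion[of t \<omega>] by (auto simp: in_cube_def)
    then show ?thesis by (auto simp: of_bool_def abs_if)
  qed
  then show ?thesis
    using False by (simp add: opinion_Suc divide_right_mono del: of_nat_Suc)
qed simp

section \<open>Measurability and conditional means of the declarations\<close>

lemma subalgebra_history: "subalgebra M (history M \<psi> t)"
proof -
  have "{(\<psi> s i) -` {True} \<inter> space M | s i. 2 \<le> s \<and> s \<le> t} \<subseteq> sets M"
    using measurable_sets[OF meas, of "{True}"] by auto
  then show ?thesis
    unfolding subalgebra_def history_def
    by (auto simp: space_measure_of_conv sets_measure_of_conv dest: sets.sigma_sets_subset)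
qed

lemma declaration_measurable_history:
  assumes "2 \<le> s" "s \<le> t" shows "Measurable.pred (history M \<psi> t) (\<psi> s i)"
proof -
  have "(\<psi> s i) -` {True} \<inter> space M \<in> {(\<psi> s i) -` {True} \<inter> space M | s i. 2 \<le> s \<and> s \<le> t}"
    using assms by blast
  then have "(\<psi> s i) -` {True} \<inter> space M \<in> sets (history M \<psi> t)"
    unfolding history_def by (subst sets_measure_of) auto
  moreover have "{\<omega> \<in> space (history M \<psi> t). \<psi> s i \<omega>} = (\<psi> s i) -` {True} \<inter> space M"
    by (auto simp: history_def space_measure_of_conv)
  ultimately show ?thesis unfolding pred_def by simp
qed

text \<open>The horizon \<open>T\<close> stays fixed during the induction, so earlier opinions and
  new declarations are measurable for one and the same sigma-algebra.\<close>

lemma opinion_measurable_history: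
  "t \<le> T \<Longrightarrow> (\<lambda>\<omega>. opinion t \<omega> i) \<in> borel_measurable (history M \<psi> T)"
proof (induction t arbitrary: i)
  case (Suc t)
  show ?case
  proof (cases t)
    case (Suc k)
    have [measurable]: "(\<lambda>\<omega>. opinion (Suc k) \<omega> i) \<in> borel_measurable (history M \<psi> T)"
      using Suc.IH Suc.prems Suc by simp
    have [measurable]: "Measurable.pred (history M \<psi> T) (\<psi> (Suc (Suc k)) i)"
      using Suc.prems Suc by (intro declaration_measurable_history) auto
    show ?thesis unfolding Suc beta.simps by measurable
  qed simp
qed simp

lemma opinion_history [measurable]:
  "(\<lambda>\<omega>. opinion t \<omega> i) \<in> borel_measurable (history M \<psi> t)"
  by (rule opinion_measurable_history) simp

lemma opinion_measurable [measurable]: "(\<lambda>\<omega>. opinion t \<omega> i) \<in> borel_measurable M"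
  by (rule measurable_from_subalg[OF subalgebra_history opinion_history])

lemma gradient_history [measurable]:
  "(\<lambda>\<omega>. gradient (opinion t \<omega>) i) \<in> borel_measurable (history M \<psi> t)"
  unfolding gradient_def mu_def fbias_def by measurable

lemma gradient_measurable [measurable]: "(\<lambda>\<omega>. gradient (opinion t \<omega>) i) \<in> borel_measurable M"
  by (rule measurable_from_subalg[OF subalgebra_history gradient_history])

lemma Fmap_measurable [measurable]: "(\<lambda>\<omega>. Fmap a \<gamma> (opinion t \<omega>) i) \<in> borel_measurable M"
  unfolding Fmap_def mu_def fbias_def by measurable

lemma potential_measurable [measurable]: "(\<lambda>\<omega>. potential (opinion t \<omega>)) \<in> borel_measurable M"
proof -
  have "(\<lambda>\<omega>. fbias_inverse_antideriv (\<gamma> i) (opinion t \<omega> i)) \<in> borel_measurable M" for i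
    unfolding fbias_inverse_antideriv_def by measurable
  then show ?thesis unfolding potential_def by measurable
qed

text \<open>Against bounded factors known at time t, a declaration may be replaced by its
  conditional mean: it is split over the possible declaration vectors, the law is applied to each,
  and the marginal of the product law is \<open>Fmap\<close>.\<close>

lemma integral_declaration:
  assumes t: "t \<ge> 1" and h: "h \<in> borel_measurable (history M \<psi> t)" and bound: "\<And>\<omega>. \<bar>h \<omega>\<bar> \<le> (B :: real)"
  shows "(\<integral>\<omega>. h \<omega> * of_bool (\<psi> (Suc t) i \<omega>) \<partial>M) = (\<integral>\<omega>. h \<omega> * Fmap a \<gamma> (opinion t \<omega>) i \<partial>M)"
proof -
  interpret finite_measure_subalgebra M "history M \<psi> t"
    by unfold_locales (rule subalgebra_history)
  have [measurable]: "h \<in> borel_measurable M" by (rule measurable_from_subalg[OF subalg h])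
  note [measurable] = meas
  define I where "I v = (indicator {\<omega>' \<in> space M. \<forall>j. \<psi> (Suc t) j \<omega>' = v j} :: 'w \<Rightarrow> real)" for v
  define P where "P v \<omega> = (\<Prod>j\<in>UNIV. if v j then Fmap a \<gamma> (opinion t \<omega>) j
      else 1 - Fmap a \<gamma> (opinion t \<omega>) j)" for v \<omega>
  have [measurable]: "I v \<in> borel_measurable M" for v unfolding I_def by measurable
  have [measurable]: "P v \<in> borel_measurable M" for v
  proof -
    have "(\<lambda>\<omega>. if v j then Fmap a \<gamma> (opinion t \<omega>) j else 1 - Fmap a \<gamma> (opinion t \<omega>) j)
        \<in> borel_measurable M" for j by (cases "v j") simp_all
    then show ?thesis unfolding P_def by measurable
  qed
  have B: "0 \<le> B" using bound order_trans[OF abs_ge_zero] by blast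
  have int: "integrable M (\<lambda>\<omega>. h \<omega> * I v \<omega>)" for v
    using bound B by (intro integrable_const_bound[of _ B]) (auto simp: I_def indicator_def)
  have P: "integrable M (\<lambda>\<omega>. h \<omega> * P v \<omega>)" "(\<integral>\<omega>. h \<omega> * I v \<omega> \<partial>M) = (\<integral>\<omega>. h \<omega> * P v \<omega> \<partial>M)" for v
  proof -
    have ae: "AE \<omega> in M. h \<omega> * real_cond_exp M (history M \<psi> t) (I v) \<omega> = h \<omega> * P v \<omega>"
      using law[OF t, of v] unfolding I_def P_def by eventually_elim simp
    have ce: "integrable M (\<lambda>\<omega>. h \<omega> * real_cond_exp M (history M \<psi> t) (I v) \<omega>)"
      "(\<integral>\<omega>. h \<omega> * real_cond_exp M (history M \<psi> t) (I v) \<omega> \<partial>M) = (\<integral>\<omega>. h \<omega> * I v \<omega> \<partial>M)"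
      using real_cond_exp_intg[OF int h, of v] by simp_all
    show "integrable M (\<lambda>\<omega>. h \<omega> * P v \<omega>)"
    proof (rule integrable_cong_AE_imp[OF ce(1)])
      show "AE \<omega> in M. h \<omega> * real_cond_exp M (history M \<psi> t) (I v) \<omega> = h \<omega> * P v \<omega>" by (rule ae)
    qed measurable
    show "(\<integral>\<omega>. h \<omega> * I v \<omega> \<partial>M) = (\<integral>\<omega>. h \<omega> * P v \<omega> \<partial>M)"
      unfolding ce(2)[symmetric] by (rule integral_cong_AE[OF _ _ ae]) measurable
  qed
  \<comment> \<open>Exactly one indicator is nonzero at \<open>\<omega>\<close>, that of the vector
    actually declared.\<close>
  have "of_bool (\<psi> (Suc t) i \<omega>) = (\<Sum>v | v i. I v \<omega>)" if "\<omega> \<in> space M" for \<omega>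
  proof -
    have "(\<Sum>v | v i. I v \<omega>) = (\<Sum>v | v i. if v = (\<lambda>j. \<psi> (Suc t) j \<omega>) then 1 else 0)"
      using that by (intro sum.cong refl) (auto simp: I_def indicator_def fun_eq_iff)
    then show ?thesis by simp
  qed
  then have "(\<integral>\<omega>. h \<omega> * of_bool (\<psi> (Suc t) i \<omega>) \<partial>M) = (\<integral>\<omega>. (\<Sum>v | v i. h \<omega> * I v \<omega>) \<partial>M)"
    by (intro Bochner_Integration.integral_cong refl) (simp add: sum_distrib_left)
  also have "\<dots> = (\<Sum>v | v i. \<integral>\<omega>. h \<omega> * P v \<omega> \<partial>M)"
    using int P(2) by (simp add: Bochner_Integration.integral_sum)
  also have "\<dots> = (\<integral>\<omega>. (\<Sum>v | v i. h \<omega> * P v \<omega>) \<partial>M)"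
    using P(1) by (simp add: Bochner_Integration.integral_sum)
  also have "\<dots> = (\<integral>\<omega>. h \<omega> * Fmap a \<gamma> (opinion t \<omega>) i \<partial>M)"
    unfolding sum_distrib_left[symmetric] P_def sum_prod_bernoulli_marginal ..
  finally show ?thesis .
qed

section \<open>Expected growth of the potential\<close>

lemma ascent_measurable [measurable]: "(\<lambda>\<omega>. ascent (opinion t \<omega>)) \<in> borel_measurable M"
  unfolding ascent_def by measurable

lemma integrable_gradient_mult:
  assumes [measurable]: "g \<in> borel_measurable M" and g: "\<And>\<omega>. 0 \<le> g \<omega> \<and> g \<omega> \<le> (1::real)"
  shows "integrable M (\<lambda>\<omega>. gradient (opinion t \<omega>) i * g \<omega>)"
proof (rule integrable_const_bound[of _ "deg a i"])
  have "\<bar>gradient (opinion t \<omega>) i\<bar> * \<bar>g \<omega>\<bar> \<le> deg a i * 1" for \<omega>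
    using gradient_bounded[OF in_cube_opinion] g[of \<omega>] deg_pos[of i] by (intro mult_mono) auto
  then show "AE \<omega> in M. norm (gradient (opinion t \<omega>) i * g \<omega>) \<le> deg a i" by (simp add: abs_mult)
qed measurable

lemma integrable_gradient_terms:
  "integrable M (\<lambda>\<omega>. gradient (opinion t \<omega>) i * opinion t \<omega> i)"
  "integrable M (\<lambda>\<omega>. gradient (opinion t \<omega>) i * Fmap a \<gamma> (opinion t \<omega>) i)"
  "integrable M (\<lambda>\<omega>. gradient (opinion t \<omega>) i * of_bool (\<psi> s i \<omega>))"
proof -
  note [measurable] = meas
  show "integrable M (\<lambda>\<omega>. gradient (opinion t \<omega>) i * opinion t \<omega> i)"
    using in_cube_opinion by (intro integrable_gradient_mult) (auto simp: in_cube_def)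
  show "integrable M (\<lambda>\<omega>. gradient (opinion t \<omega>) i * Fmap a \<gamma> (opinion t \<omega>) i)"
    using Fmap_range[OF in_cube_opinion] by (intro integrable_gradient_mult) auto
  show "integrable M (\<lambda>\<omega>. gradient (opinion t \<omega>) i * of_bool (\<psi> s i \<omega>))"
    by (intro integrable_gradient_mult) auto
qed

lemma integrable_ascent: "integrable M (\<lambda>\<omega>. ascent (opinion t \<omega>))"
  unfolding ascent_def right_diff_distrib
  by (intro Bochner_Integration.integrable_sum Bochner_Integration.integrable_diff integrable_gradient_terms)

lemma integrable_potential: "integrable M (\<lambda>\<omega>. potential (opinion t \<omega>))"
proof -
  obtain B where "\<And>b. in_cube b \<Longrightarrow> \<bar>potential b\<bar> \<le> B" using potential_bounded by blast
  then show ?thesis using in_cube_opinion by (intro integrable_const_bound[of _ B]) auto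
qed

text \<open>The expectation of \<open>potential_lower\<close> along one step of size at most
  \<open>1 / Suc t\<close>; the first-order term averages to \<open>ascent\<close> by
  \<open>integral_declaration\<close>.\<close>

lemma expected_ascent_le:
  assumes t: "t \<ge> 1"
  shows "expectation (\<lambda>\<omega>. ascent (opinion t \<omega>)) / real (Suc t)
    \<le> expectation (\<lambda>\<omega>. potential (opinion (Suc t) \<omega>)) - expectation (\<lambda>\<omega>. potential (opinion t \<omega>))
      + curvature * (1 / real (Suc t))\<^sup>2"
proof -
  \<comment> \<open>The realised first-order gain times \<open>Suc t\<close>, with the random
    declarations in the place of \<open>Fmap\<close>.\<close>
  define D where "D \<omega> = (\<Sum>i\<in>UNIV. gradient (opinion t \<omega>) i * of_bool (\<psi> (Suc t) i \<omega>)
      - gradient (opinion t \<omega>) i * opinion t \<omega> i)" for \<omega>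
  have D: "integrable M D"
    unfolding D_def
    by (intro Bochner_Integration.integrable_sum Bochner_Integration.integrable_diff integrable_gradient_terms)
  have "expectation D = expectation (\<lambda>\<omega>. ascent (opinion t \<omega>))"
    unfolding D_def ascent_def right_diff_distrib
    by (simp add: integrable_gradient_terms
        integral_declaration[OF t gradient_history gradient_bounded[OF in_cube_opinion]])
  have "potential (opinion t \<omega>) + D \<omega> / real (Suc t) - curvature * (1 / real (Suc t))\<^sup>2
      \<le> potential (opinion (Suc t) \<omega>)" for \<omega>
  proof -
    have "(\<Sum>i\<in>UNIV. gradient (opinion t \<omega>) i * (opinion (Suc t) \<omega> i - opinion t \<omega> i)) = D \<omega> / real (Suc t)"
      unfolding opinion_Suc[OF t] D_def sum_divide_distrib
      by (intro sum.cong refl) (simp add: right_diff_distrib)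
    then show ?thesis
      using potential_lower[OF in_cube_opinion in_cube_opinion opinion_step, of t \<omega>] by metis
  qed
  then have "expectation (\<lambda>\<omega>. potential (opinion t \<omega>) + D \<omega> / real (Suc t) - curvature * (1 / real (Suc t))\<^sup>2)
      \<le> expectation (\<lambda>\<omega>. potential (opinion (Suc t) \<omega>))"
    by (intro integral_mono Bochner_Integration.integrable_diff Bochner_Integration.integrable_add
        Bochner_Integration.integrable_divide_zero integrable_potential D) simp_all
  moreover have "expectation (\<lambda>\<omega>. potential (opinion t \<omega>) + D \<omega> / real (Suc t) - curvature * (1 / real (Suc t))\<^sup>2)
    = expectation (\<lambda>\<omega>. potential (opinion t \<omega>)) + expectation D / real (Suc t) - curvature * (1 / real (Suc t))\<^sup>2"
    using D integrable_potential by (simp add: prob_space del: of_nat_Suc)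
  ultimately show ?thesis unfolding \<open>expectation D = _\<close> by simp
qed

lemma curvature_nonneg: "0 \<le> curvature"
  unfolding curvature_def using nonneg gpos deg_pos
  by (intro add_nonneg_nonneg divide_nonneg_nonneg sum_nonneg mult_nonneg_nonneg)
    (auto simp: less_imp_le)

text \<open>The potential differences telescope and stay bounded, and the second-order losses are
  summable like \<open>1 / t\<^sup>2\<close>; as the terms are nonnegative, bounded partial sums
  suffice.\<close>

lemma summable_expected_ascent:
  "summable (\<lambda>t. expectation (\<lambda>\<omega>. ascent (opinion t \<omega>)) / real (Suc t))" (is "summable ?e")
proof -
  obtain B where B: "\<And>b. in_cube b \<Longrightarrow> \<bar>potential b\<bar> \<le> B" using potential_bounded by blast
  define p where "p t = expectation (\<lambda>\<omega>. potential (opinion t \<omega>))" for t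
  have p: "\<bar>p t\<bar> \<le> B" for t
  proof -
    have "\<bar>p t\<bar> \<le> expectation (\<lambda>\<omega>. \<bar>potential (opinion t \<omega>)\<bar>)"
      unfolding p_def by (rule integral_abs_bound)
    also have "\<dots> \<le> expectation (\<lambda>\<omega>. B)"
      using B in_cube_opinion by (intro integral_mono integrable_abs integrable_potential) auto
    finally show ?thesis by (simp add: prob_space)
  qed
  \<comment> \<open>The one-step estimate holds from time 1 on, so the index is shifted and the step
    at \<open>Suc t\<close> has size \<open>1 / Suc (Suc t)\<close>.\<close>
  define s where "s t = (1 / real (Suc (Suc t)))\<^sup>2" for t
  have "summable (\<lambda>t. inverse (real t ^ 2))" by (rule inverse_power_summable) simp
  then have s: "summable s"
    unfolding s_def by (subst (asm) summable_Suc_iff[symmetric])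
      (subst (asm) summable_Suc_iff[symmetric], simp add: power_divide inverse_eq_divide)
  have e: "?e (Suc t) \<le> (p (Suc (Suc t)) - p (Suc t)) + curvature * s t" for t
    using expected_ascent_le[of "Suc t"] by (simp add: p_def s_def)
  have "summable (\<lambda>t. ?e (Suc t))"
  proof (rule summableI_nonneg_bounded)
    show "0 \<le> ?e (Suc t)" for t
      using ascent_nonneg[OF in_cube_opinion] by (intro divide_nonneg_nonneg integral_nonneg) auto
    fix n
    have "(\<Sum>t<n. ?e (Suc t)) \<le> (\<Sum>t<n. (p (Suc (Suc t)) - p (Suc t)) + curvature * s t)"
      by (intro sum_mono e)
    also have "\<dots> = (p (Suc n) - p (Suc 0)) + curvature * (\<Sum>t<n. s t)"
      using sum_lessThan_telescope[of "\<lambda>t. p (Suc t)" n]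
      by (simp add: sum.distrib sum_distrib_left)
    also have "\<dots> \<le> 2 * B + curvature * suminf s"
    proof -
      have "(\<Sum>t<n. s t) \<le> suminf s" by (intro sum_le_suminf s) (auto simp: s_def)
      then have "curvature * (\<Sum>t<n. s t) \<le> curvature * suminf s"
        by (intro mult_left_mono curvature_nonneg)
      then show ?thesis using p[of "Suc n"] p[of "Suc 0"] by linarith
    qed
    finally show "(\<Sum>t<n. ?e (Suc t)) \<le> 2 * B + curvature * suminf s" .
  qed
  then show ?thesis by (subst (asm) summable_Suc_iff)
qed

text \<open>The terms are nonnegative, so sum and expectation may be exchanged; a finite expected
  sum is finite almost surely.\<close>

lemma AE_summable_ascent: "AE \<omega> in M. summable (\<lambda>t. ascent (opinion t \<omega>) / real (Suc t))"
proof -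
  have nn: "0 \<le> ascent (opinion t \<omega>) / real (Suc t)" for t \<omega>
    using ascent_nonneg[OF in_cube_opinion] by (intro divide_nonneg_nonneg) auto
  have "(\<integral>\<^sup>+\<omega>. ennreal (ascent (opinion t \<omega>) / real (Suc t)) \<partial>M)
      = ennreal (expectation (\<lambda>\<omega>. ascent (opinion t \<omega>)) / real (Suc t))" for t
    using nn integrable_ascent by (subst nn_integral_eq_integral) auto
  then have "(\<integral>\<^sup>+\<omega>. (\<Sum>t. ennreal (ascent (opinion t \<omega>) / real (Suc t))) \<partial>M)
      = (\<Sum>t. ennreal (expectation (\<lambda>\<omega>. ascent (opinion t \<omega>)) / real (Suc t)))"
    by (subst nn_integral_suminf) (simp_all del: of_nat_Suc)
  also have "\<dots> \<noteq> top"
    using ascent_nonneg[OF in_cube_opinion]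
    by (subst suminf_ennreal2[OF _ summable_expected_ascent]) (auto intro!: integral_nonneg divide_nonneg_nonneg)
  finally have "AE \<omega> in M. (\<Sum>t. ennreal (ascent (opinion t \<omega>) / real (Suc t))) \<noteq> top"
    unfolding infinity_ennreal_def[symmetric]
    by (intro nn_integral_PInf_AE) (simp_all del: of_nat_Suc)
  then show ?thesis
    by eventually_elim (rule summable_suminf_not_top[OF nn])
qed

end

theorem theorem2:
  fixes M :: "'w measure"
    and a :: "'n::finite \<Rightarrow> 'n \<Rightarrow> real"
    and \<gamma> :: "'n \<Rightarrow> real"
    and b1 :: "'n \<Rightarrow> real"
    and \<psi> :: "nat \<Rightarrow> 'n \<Rightarrow> 'w \<Rightarrow> bool"
  assumes "prob_space M"
    and sym: "\<And>i j. a i j = a j i"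
    and nonneg: "\<And>i j. a i j \<ge> 0"
    and conn: "graph_connected a"
    and nonbip: "\<not> graph_bipartite a"
    and gpos: "\<And>i. \<gamma> i > 0"
    and gnot1: "\<exists>i. \<gamma> i \<noteq> 1"
    and b1: "\<And>i. 0 < b1 i \<and> b1 i < 1"
    and meas: "\<And>t i. \<psi> t i \<in> measurable M (count_space UNIV)"
    and law: "\<And>t (v :: 'n \<Rightarrow> bool). t \<ge> 1 \<Longrightarrow>
       AE \<omega> in M. real_cond_exp M (history M \<psi> t)
           (indicator {\<omega>' \<in> space M. \<forall>i. \<psi> (Suc t) i \<omega>' = v i} :: 'w \<Rightarrow> real) \<omega>
         = (\<Prod>i\<in>UNIV. if v i then Fmap a \<gamma> (beta \<psi> b1 t \<omega>) i
                              else 1 - Fmap a \<gamma> (beta \<psi> b1 t \<omega>) i)"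
  shows "AE \<omega> in M. \<exists>b :: 'n \<Rightarrow> real.
           (\<forall>i. 0 \<le> b i \<and> b i \<le> 1) \<and> Fmap a \<gamma> b = b \<and>
           (\<forall>i. (\<lambda>t. beta \<psi> b1 t \<omega> i) \<longlonglongrightarrow> b i)"
proof -
  interpret prob_space M by fact
  interpret opinion_process a \<gamma> M b1 \<psi>
    by unfold_locales (fact sym nonneg conn nonbip gpos gnot1 b1 meas law)+
  \<comment> \<open>All randomness is now confined to one almost sure event, on which the pathwise
    argument applies.\<close>
  show ?thesis
    using AE_summable_ascent
  proof eventually_elim
    case (elim \<omega>)
    then show ?case
      using converges_to_fixed_point[of "\<lambda>t. beta \<psi> b1 t \<omega>"] in_cube_opinion opinion_step
      by (simp add: in_cube_def)
  qed
qed

end
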